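(* Let $G$ be the Grushin plane, $\Omega\subset G$ an open set, $1<p<\infty$ and $\lambda\in\mathbb{R}$. Let $v$ be a positive sub-solution of $$-\nabla_G\cdot(|\nabla_G u|^{p-2}\nabla_G u)=\lambda|u|^{p-2}u\ \text{ in }\Omega,\qquad u=0\ \text{ on }\partial\Omega.$$ Then for every fixed $q>p-1$ we have $$\int_{\Omega}v^{q-p}\phi^p|\nabla_G v|^p\,dx\le\left(\frac{p}{q-p+1}\right)^p\int_\Omega v^q|\nabla_G\phi|^p\,dx+\frac{\lambda p}{q-p+1}\int_\Omega v^q\phi^p\,dx,$$ and for $q=p$ and $\lambda=0$ we have $$\int_\Omega\phi^p|\nabla_G v|^p\,dx\le p^p\int_\Omega v^p|\nabla_G\phi|^p\,dx,$$ for all nonnegative functions $\phi\in C_0^\infty(\Omega)$.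
   Context: The Grushin plane $G$ is $\mathbb{R}^2$, with points $x=(x_1,x_2)$ and Lebesgue measure $dx$, equipped with the vector fields $X_1=\frac{\partial}{\partial x_1}$, $X_2=x_1\frac{\partial}{\partial x_2}$, and gradient $\nabla_G=(X_1,X_2)$. Here $\langle\cdot,\cdot\rangle$ is the Euclidean inner product on $\mathbb{R}^2$, $|\nabla_G u|=\left((X_1u)^2+(X_2u)^2\right)^{1/2}$, and $\nabla_G\cdot(F_1,F_2)=X_1F_1+X_2F_2$. $\mathring{S}^{1,p}(\Omega)$ is the completion of $C_0^1(\Omega)$ in the norm $\left(\int_\Omega|\nabla_G u|^p dx\right)^{1/p}$; functions are real-valued. A sub-solution of the Dirichlet problem (with parameter $\lambda$) is a function $u\in\mathring{S}^{1,p}(\Omega)$ such that $$\int_\Omega|\nabla_G u|^{p-2}\langle\nabla_G u,\nabla_G\phi\rangle dx-\lambda\int_\Omega|u|^{p-2}u\phi\,dx\le 0$$ for all nonnegative $\phi\in\mathring{S}^{1,p}(\Omega)$. *)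

theory Defs
  imports "HOL-Analysis.Analysis"
begin

type_synonym plane = "real \<times> real"

definition partial1 :: "(plane \<Rightarrow> real) \<Rightarrow> plane \<Rightarrow> real" where
  "partial1 u x = deriv (\<lambda>t. u (t, snd x)) (fst x)"

definition partial2 :: "(plane \<Rightarrow> real) \<Rightarrow> plane \<Rightarrow> real" where
  "partial2 u x = deriv (\<lambda>t. u (fst x, t)) (snd x)"

definition grushin_grad :: "(plane \<Rightarrow> real) \<Rightarrow> plane \<Rightarrow> plane" where
  "grushin_grad u x = (partial1 u x, fst x * partial2 u x)"

fun Ck :: "nat \<Rightarrow> (plane \<Rightarrow> real) \<Rightarrow> bool" where
  "Ck 0 u \<longleftrightarrow> continuous_on UNIV u"
| "Ck (Suc k) u \<longleftrightarrow> (\<forall>x. u differentiable (at x)) \<and> Ck k (partial1 u) \<and> Ck k (partial2 u)"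

text \<open>A compactly supported function on an open set \<open>\<Omega>\<close> is identified with its extension by
  zero to the whole plane.\<close>

definition compact_support_in :: "plane set \<Rightarrow> (plane \<Rightarrow> real) \<Rightarrow> bool" where
  "compact_support_in \<Omega> u \<longleftrightarrow>
     compact (closure {x. u x \<noteq> 0}) \<and> closure {x. u x \<noteq> 0} \<subseteq> \<Omega>"

definition C01 :: "plane set \<Rightarrow> (plane \<Rightarrow> real) set" where
  "C01 \<Omega> = {u. Ck 1 u \<and> compact_support_in \<Omega> u}"

definition C0_infinity :: "plane set \<Rightarrow> (plane \<Rightarrow> real) set" where
  "C0_infinity \<Omega> = {u. (\<forall>k. Ck k u) \<and> compact_support_in \<Omega> u}"

text \<open>The completion of \<open>C01 \<Omega>\<close> in the norm \<open>(\<integral> |grushin_grad u|^p)^(1/p)\<close>, realised by functions: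
  \<open>S1p p \<Omega> u U\<close> says that \<open>u\<close> represents an element of the completion whose Grushin gradient is \<open>U\<close>.
  Since \<open>L^p\<close> is complete, a Cauchy sequence \<open>w\<close> in this norm is one whose gradients converge
  in \<open>L^p(\<Omega>)\<close> to some \<open>U\<close>; the function representing its limit is the limit of \<open>w\<close> in
  \<open>L^p\<^sub>l\<^sub>o\<^sub>c(\<Omega>)\<close>. The two convergences make \<open>U\<close> the distributional gradient
  \<open>(X\<^sub>1 u, X\<^sub>2 u)\<close>, so \<open>u\<close> determines \<open>U\<close> almost everywhere.\<close>

definition S1p :: "real \<Rightarrow> plane set \<Rightarrow> (plane \<Rightarrow> real) \<Rightarrow> (plane \<Rightarrow> plane) \<Rightarrow> bool" where
  "S1p p \<Omega> u U \<longleftrightarrow>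
     u \<in> borel_measurable (lebesgue_on \<Omega>) \<and> U \<in> borel_measurable (lebesgue_on \<Omega>) \<and>
     (\<exists>w :: nat \<Rightarrow> plane \<Rightarrow> real.
        (\<forall>n. w n \<in> C01 \<Omega>) \<and>
        (\<lambda>n. \<integral>\<^sup>+ x. ennreal (norm (grushin_grad (w n) x - U x) powr p) \<partial>lebesgue_on \<Omega>)
           \<longlonglongrightarrow> 0 \<and>
        (\<forall>K. compact K \<and> K \<subseteq> \<Omega> \<longrightarrow>
           (\<lambda>n. \<integral>\<^sup>+ x. ennreal (\<bar>w n x - u x\<bar> powr p) \<partial>lebesgue_on K) \<longlonglongrightarrow> 0))"

text \<open>\<open>grushin_subsolution p lam \<Omega> u U\<close>: \<open>u\<close> is a sub-solution, with Grushin gradient \<open>U\<close>.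
  The first integral below converges for all \<open>\<phi>\<close>, by Hoelder. For unbounded \<open>\<Omega>\<close> and \<open>lam \<noteq> 0\<close> the
  second need not; the inequality is demanded of those \<open>\<phi>\<close> for which it does, so that the value 0
  of a divergent Bochner integral plays no role. For bounded \<open>\<Omega>\<close>, this is every \<open>\<phi>\<close>, by the
  Poincare inequality.\<close>

definition grushin_subsolution ::
  "real \<Rightarrow> real \<Rightarrow> plane set \<Rightarrow> (plane \<Rightarrow> real) \<Rightarrow> (plane \<Rightarrow> plane) \<Rightarrow> bool" where
  "grushin_subsolution p lam \<Omega> u U \<longleftrightarrow>
     S1p p \<Omega> u U \<and>
     (\<forall>\<phi> \<Phi>. S1p p \<Omega> \<phi> \<Phi> \<and> (AE x in lebesgue_on \<Omega>. 0 \<le> \<phi> x) \<and>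
        integrable (lebesgue_on \<Omega>) (\<lambda>x. lam * (\<bar>u x\<bar> powr (p - 2) * u x * \<phi> x)) \<longrightarrow>
        (\<integral>x. norm (U x) powr (p - 2) * (U x \<bullet> \<Phi> x) \<partial>lebesgue_on \<Omega>)
          - lam * (\<integral>x. \<bar>u x\<bar> powr (p - 2) * u x * \<phi> x \<partial>lebesgue_on \<Omega>) \<le> 0)"

text \<open>The integral of a nonnegative function, with values in \<open>[0, \<infinity>]\<close>; it lands in \<open>ereal\<close>
  because it may be multiplied with a negative coefficient. In \<open>ereal\<close>, \<open>\<infinity> + (-\<infinity>) = \<infinity>\<close>, so
  an upper bound that is an undefined difference of infinite integrals asserts nothing.\<close>

definition ext_integral :: "plane set \<Rightarrow> (plane \<Rightarrow> real) \<Rightarrow> ereal" where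
  "ext_integral \<Omega> f = enn2ereal (\<integral>\<^sup>+ x. ennreal (f x) \<partial>lebesgue_on \<Omega>)"

end

theory Submission
  imports Defs
begin

text \<open>
  Put \<open>s = q - p + 1 > 0\<close> and test the sub-solution inequality with \<open>\<phi>\<^sup>p v\<^sup>s\<close>.
  Young's inequality absorbs the mixed term \<open>p \<phi>\<^bsup>p-1\<^esup> v\<^sup>s |\<nabla>v|\<^bsup>p-1\<^esup> |\<nabla>\<phi>|\<close> into a fraction
  \<open>1 - 1/p\<close> of the left-hand side, and leaves exactly the stated constants.
  Since \<open>v\<^sup>s\<close> may be unbounded and \<open>t\<^sup>s\<close> singular at \<open>0\<close>, the power is replaced by \<open>G\<^sub>n(v)\<close>, where
  \<open>G\<^sub>n\<close> has a bounded continuous derivative \<open>g\<^sub>n\<close>, \<open>0 \<le> G\<^sub>n(t) \<le> t\<^sup>s\<close>, and \<open>G\<^sub>n \<le> \<kappa> t g\<^sub>n\<close> with \<open>\<kappa>\<close>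
  independent of \<open>n\<close>. The last bound dominates \<open>g\<^sub>n (G\<^sub>n / g\<^sub>n)\<^sup>p |\<nabla>\<phi>|\<^sup>p\<close> by a multiple of
  \<open>v\<^sup>q |\<nabla>\<phi>|\<^sup>p\<close>, so the limit \<open>n \<longrightarrow> \<infinity>\<close> follows from Fatou's lemma on the left and dominated
  convergence on the right.
\<close>

section \<open>Grushin gradients of continuously differentiable functions\<close>

lemma DERIV_partial1:
  assumes "u differentiable (at x)"
  shows "((\<lambda>t. u (t, snd x)) has_real_derivative partial1 u x) (at (fst x))"
proof -
  have "(\<lambda>t. (t, snd x)) differentiable (at (fst x))"
    unfolding differentiable_def by (auto intro!: exI derivative_eq_intros)
  moreover have "u differentiable (at (fst x, snd x))"
    using assms by simp
  ultimately have "(\<lambda>t. u (t, snd x)) differentiable (at (fst x))"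
    using differentiable_chain_at[of "\<lambda>t. (t, snd x)" "fst x" u] by (simp add: o_def)
  then show ?thesis
    unfolding partial1_def by (simp add: DERIV_deriv_iff_real_differentiable)
qed

lemma DERIV_partial2:
  assumes "u differentiable (at x)"
  shows "((\<lambda>t. u (fst x, t)) has_real_derivative partial2 u x) (at (snd x))"
proof -
  have "(\<lambda>t. (fst x, t)) differentiable (at (snd x))"
    unfolding differentiable_def by (auto intro!: exI derivative_eq_intros)
  moreover have "u differentiable (at (fst x, snd x))"
    using assms by simp
  ultimately have "(\<lambda>t. u (fst x, t)) differentiable (at (snd x))"
    using differentiable_chain_at[of "\<lambda>t. (fst x, t)" "snd x" u] by (simp add: o_def)
  then show ?thesis
    unfolding partial2_def by (simp add: DERIV_deriv_iff_real_differentiable)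
qed

lemma Ck_1_iff:
  "Ck 1 u \<longleftrightarrow> (\<forall>x. u differentiable (at x)) \<and> continuous_on UNIV (partial1 u)
     \<and> continuous_on UNIV (partial2 u)"
  by (simp add: One_nat_def)

lemma Ck_1_imp_continuous: "Ck 1 u \<Longrightarrow> continuous_on UNIV u"
  unfolding Ck_1_iff by (simp add: continuous_on_eq_continuous_at differentiable_imp_continuous_within)

lemma Ck_1_imp_continuous_grad: "Ck 1 u \<Longrightarrow> continuous_on UNIV (grushin_grad u)"
  unfolding Ck_1_iff grushin_grad_def[abs_def] by (auto intro!: continuous_intros)

lemma Ck_1_const: "Ck 1 (\<lambda>x. c)"
  by (auto simp: Ck_1_iff partial1_def partial2_def)

lemma
  assumes \<zeta>: "Ck 1 \<zeta>" and w: "Ck 1 w"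
    and G: "\<And>t. (G has_real_derivative g t) (at t)" and g: "continuous_on UNIV g"
  shows Ck_1_mult_comp: "Ck 1 (\<lambda>x. \<zeta> x * G (w x))"
    and grushin_grad_mult_comp: "grushin_grad (\<lambda>x. \<zeta> x * G (w x)) x
      = G (w x) *\<^sub>R grushin_grad \<zeta> x + (\<zeta> x * g (w x)) *\<^sub>R grushin_grad w x"
proof -
  have d: "\<zeta> differentiable (at x)" "w differentiable (at x)" for x
    using \<zeta> w by (simp_all add: Ck_1_iff del: split_paired_All)
  have p1: "partial1 (\<lambda>x. \<zeta> x * G (w x)) x = G (w x) * partial1 \<zeta> x + \<zeta> x * g (w x) * partial1 w x" for x
  proof -
    have "((\<lambda>t. \<zeta> (t, snd x) * G (w (t, snd x))) has_real_derivative
        partial1 \<zeta> x * G (w (fst x, snd x)) + (g (w (fst x, snd x)) * partial1 w x) * \<zeta> (fst x, snd x)) (at (fst x))"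
      using DERIV_mult[OF DERIV_partial1[OF d(1)[of x]] DERIV_chain2[OF G DERIV_partial1[OF d(2)[of x]]]] by simp
    from DERIV_imp_deriv[OF this] show ?thesis
      unfolding partial1_def[of "\<lambda>x. \<zeta> x * G (w x)"] by (simp add: algebra_simps)
  qed
  have p2: "partial2 (\<lambda>x. \<zeta> x * G (w x)) x = G (w x) * partial2 \<zeta> x + \<zeta> x * g (w x) * partial2 w x" for x
  proof -
    have "((\<lambda>t. \<zeta> (fst x, t) * G (w (fst x, t))) has_real_derivative
        partial2 \<zeta> x * G (w (fst x, snd x)) + (g (w (fst x, snd x)) * partial2 w x) * \<zeta> (fst x, snd x)) (at (snd x))"
      using DERIV_mult[OF DERIV_partial2[OF d(1)[of x]] DERIV_chain2[OF G DERIV_partial2[OF d(2)[of x]]]] by simp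
    from DERIV_imp_deriv[OF this] show ?thesis
      unfolding partial2_def[of "\<lambda>x. \<zeta> x * G (w x)"] by (simp add: algebra_simps)
  qed
  have G': "G differentiable (at t)" for t
    using G real_differentiable_def by blast
  have c: "continuous_on UNIV \<zeta>" "continuous_on UNIV w"
    using \<zeta> w by (auto intro: Ck_1_imp_continuous)
  have cG: "continuous_on UNIV G"
    using G' by (simp add: continuous_on_eq_continuous_at differentiable_imp_continuous_within)
  have cc: "continuous_on UNIV (\<lambda>x. G (w x))" "continuous_on UNIV (\<lambda>x. g (w x))"
    using continuous_on_compose2[OF cG c(2)] continuous_on_compose2[OF g c(2)] by auto
  have "(\<lambda>x. \<zeta> x * G (w x)) differentiable (at x)" for x
    using differentiable_mult[OF d(1) differentiable_chain_at[OF d(2) G', unfolded o_def]] by simp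
  then show "Ck 1 (\<lambda>x. \<zeta> x * G (w x))"
    using \<zeta> w c cc unfolding Ck_1_iff p1[abs_def] p2[abs_def]
    by (auto intro!: continuous_intros)
  show "grushin_grad (\<lambda>x. \<zeta> x * G (w x)) x
      = G (w x) *\<^sub>R grushin_grad \<zeta> x + (\<zeta> x * g (w x)) *\<^sub>R grushin_grad w x"
    by (simp add: grushin_grad_def p1 p2 algebra_simps)
qed

lemma grushin_grad_zero_outside_support:
  assumes "x \<notin> closure {x. u x \<noteq> 0}"
  shows "grushin_grad u x = 0"
proof -
  let ?S = "- closure {x. u x \<noteq> 0}"
  have o: "open ?S" by auto
  have z: "u y = 0" if "y \<in> ?S" for y
    using that closure_subset[of "{x. u x \<noteq> 0}"] by auto
  have "partial1 u x = 0"
  proof -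
    have "((\<lambda>t. (t, snd x)) \<longlongrightarrow> (fst x, snd x)) (nhds (fst x))"
      by (intro tendsto_intros filterlim_ident)
    from topological_tendstoD[OF this o] have "\<forall>\<^sub>F t in nhds (fst x). (t, snd x) \<in> ?S"
      using assms by simp
    then have "\<forall>\<^sub>F t in nhds (fst x). u (t, snd x) = 0"
      by (rule eventually_mono) (rule z)
    then show ?thesis unfolding partial1_def
      by (subst deriv_cong_ev[where g="\<lambda>_. 0"]) auto
  qed
  moreover have "partial2 u x = 0"
  proof -
    have "((\<lambda>t. (fst x, t)) \<longlongrightarrow> (fst x, snd x)) (nhds (snd x))"
      by (intro tendsto_intros filterlim_ident)
    from topological_tendstoD[OF this o] have "\<forall>\<^sub>F t in nhds (snd x). (fst x, t) \<in> ?S"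
      using assms by simp
    then have "\<forall>\<^sub>F t in nhds (snd x). u (fst x, t) = 0"
      by (rule eventually_mono) (rule z)
    then show ?thesis unfolding partial2_def
      by (subst deriv_cong_ev[where g="\<lambda>_. 0"]) auto
  qed
  ultimately show ?thesis by (simp add: grushin_grad_def zero_prod_def)
qed

lemma has_real_derivative_abs_powr:
  fixes p :: real
  assumes "1 < p"
  shows "((\<lambda>t. \<bar>t\<bar> powr p) has_real_derivative p * \<bar>t\<bar> powr (p - 1) * sgn t) (at t)"
proof (cases "t = 0")
  case True
  have "((\<lambda>h. \<bar>h\<bar> powr (p - 1)) \<longlongrightarrow> 0) (at (0::real))"
    using assms by (intro tendsto_eq_intros | simp)+
  then have "((\<lambda>h. \<bar>h\<bar> powr p / h) \<longlongrightarrow> 0) (at (0::real))"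
    by (rule Lim_null_comparison[rotated])
       (auto simp: eventually_at_filter powr_diff abs_mult)
  then show ?thesis
    using True assms by (simp add: has_field_derivative_iff)
next
  case False
  have "((\<lambda>t. \<bar>t\<bar>) has_real_derivative sgn t) (at t)"
  proof (cases "t > 0")
    case True
    then have "((\<lambda>t. \<bar>t\<bar>) has_real_derivative 1) (at t)"
      using has_field_derivative_transform_within_open[OF DERIV_ident[of "at t"] open_greaterThan[of 0]]
      by simp
    with True show ?thesis by simp
  next
    case f: False
    have "((\<lambda>t. - t) has_real_derivative - 1) (at t)"
      by (auto intro!: derivative_eq_intros)
    from has_field_derivative_transform_within_open[OF this open_lessThan[of 0]]
    have "((\<lambda>t. \<bar>t\<bar>) has_real_derivative - 1) (at t)"
      using f False by simp
    then show ?thesis using f False by simp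
  qed
  from DERIV_powr[OF this _ DERIV_const[of p]] False show ?thesis
    by (simp add: field_simps powr_diff)
qed

lemma continuous_abs_powr_sgn:
  assumes "0 < (a::real)"
  shows "continuous_on UNIV (\<lambda>t. \<bar>t\<bar> powr a * sgn t)"
proof -
  have "(\<lambda>t. \<bar>t\<bar> powr a * sgn t) = (\<lambda>t. max 0 t powr a - max 0 (- t) powr a)"
    using assms by (auto simp: fun_eq_iff sgn_if)
  moreover have "continuous_on UNIV (\<lambda>t. max 0 t powr a - max 0 (- t) powr a)"
    using assms by (intro continuous_intros continuous_on_powr') auto
  ultimately show ?thesis by (simp only:)
qed

section \<open>Convergence in \<open>L\<^sup>p\<close>\<close>

lemma powr_add_le:
  fixes a b p :: real
  assumes "0 \<le> a" "0 \<le> b" "0 \<le> p"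
  shows "(a + b) powr p \<le> 2 powr p * (a powr p + b powr p)"
proof -
  have "(a + b) powr p \<le> (2 * max a b) powr p"
    using assms by (intro powr_mono2) auto
  also have "\<dots> = 2 powr p * max a b powr p"
    using assms by (intro powr_mult)
  also have "\<dots> \<le> 2 powr p * (a powr p + b powr p)"
    by (intro mult_left_mono) (auto simp: max_def)
  finally show ?thesis .
qed

lemma norm_powr_add_le:
  fixes x y :: "'a::real_normed_vector"
  assumes "0 \<le> p"
  shows "norm (x + y) powr p \<le> 2 powr p * (norm x powr p + norm y powr p)"
proof -
  have "norm (x + y) powr p \<le> (norm x + norm y) powr p"
    using assms by (intro powr_mono2 norm_triangle_ineq) auto
  also have "\<dots> \<le> 2 powr p * (norm x powr p + norm y powr p)"
    using assms by (intro powr_add_le) auto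
  finally show ?thesis .
qed

lemma nn_integral_norm_powr_add_le:
  fixes f g :: "'a \<Rightarrow> 'b::euclidean_space"
  assumes [measurable]: "f \<in> borel_measurable M" "g \<in> borel_measurable M" and p: "0 \<le> p"
  shows "(\<integral>\<^sup>+x. ennreal (norm (f x + g x) powr p) \<partial>M) \<le> ennreal (2 powr p) *
    ((\<integral>\<^sup>+x. ennreal (norm (f x) powr p) \<partial>M) + (\<integral>\<^sup>+x. ennreal (norm (g x) powr p) \<partial>M))"
proof -
  have "(\<integral>\<^sup>+x. ennreal (norm (f x + g x) powr p) \<partial>M)
      \<le> (\<integral>\<^sup>+x. ennreal (2 powr p) * (ennreal (norm (f x) powr p) + ennreal (norm (g x) powr p)) \<partial>M)"
    using norm_powr_add_le[OF p]
    by (intro nn_integral_mono) (simp add: ennreal_mult'[symmetric] ennreal_plus[symmetric] ennreal_leI del: ennreal_plus)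
  also have "\<dots> = ennreal (2 powr p) *
    ((\<integral>\<^sup>+x. ennreal (norm (f x) powr p) \<partial>M) + (\<integral>\<^sup>+x. ennreal (norm (g x) powr p) \<partial>M))"
    by (simp add: nn_integral_cmult nn_integral_add)
  finally show ?thesis .
qed

lemma Lp_null_comparison:
  fixes f :: "nat \<Rightarrow> 'a \<Rightarrow> 'b::real_normed_vector" and a :: "nat \<Rightarrow> 'a \<Rightarrow> 'c::euclidean_space"
  assumes [measurable]: "\<And>n. a n \<in> borel_measurable M" and p: "0 \<le> p"
    and le: "\<And>n x. x \<in> space M \<Longrightarrow> norm (f n x) \<le> B * norm (a n x)" and B: "0 \<le> B"
    and lim: "(\<lambda>n. \<integral>\<^sup>+x. ennreal (norm (a n x) powr p) \<partial>M) \<longlonglongrightarrow> 0"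
  shows "(\<lambda>n. \<integral>\<^sup>+x. ennreal (norm (f n x) powr p) \<partial>M) \<longlonglongrightarrow> 0"
proof (rule tendsto_sandwich[OF _ _ tendsto_const])
  show "\<forall>\<^sub>F n in sequentially. (\<integral>\<^sup>+x. ennreal (norm (f n x) powr p) \<partial>M)
      \<le> ennreal (B powr p) * (\<integral>\<^sup>+x. ennreal (norm (a n x) powr p) \<partial>M)"
  proof (intro always_eventually allI)
    fix n
    have "norm (f n x) powr p \<le> B powr p * norm (a n x) powr p" if "x \<in> space M" for x
      using powr_mono2[OF p norm_ge_zero le[OF that]] B by (simp add: powr_mult)
    then have "(\<integral>\<^sup>+x. ennreal (norm (f n x) powr p) \<partial>M)
        \<le> (\<integral>\<^sup>+x. ennreal (B powr p) * ennreal (norm (a n x) powr p) \<partial>M)"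
      by (intro nn_integral_mono) (simp add: ennreal_mult'[symmetric] ennreal_leI)
    also have "\<dots> = ennreal (B powr p) * (\<integral>\<^sup>+x. ennreal (norm (a n x) powr p) \<partial>M)"
      by (simp add: nn_integral_cmult)
    finally show "(\<integral>\<^sup>+x. ennreal (norm (f n x) powr p) \<partial>M)
      \<le> ennreal (B powr p) * (\<integral>\<^sup>+x. ennreal (norm (a n x) powr p) \<partial>M)" .
  qed
  show "(\<lambda>n. ennreal (B powr p) * (\<integral>\<^sup>+x. ennreal (norm (a n x) powr p) \<partial>M)) \<longlonglongrightarrow> 0"
    using ennreal_tendsto_cmult[OF _ lim, of "ennreal (B powr p)"] by simp
qed auto

lemma Lp_null_add:
  fixes f g :: "nat \<Rightarrow> 'a \<Rightarrow> 'b::euclidean_space"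
  assumes [measurable]: "\<And>n. f n \<in> borel_measurable M" "\<And>n. g n \<in> borel_measurable M" and p: "0 \<le> p"
    and f: "(\<lambda>n. \<integral>\<^sup>+x. ennreal (norm (f n x) powr p) \<partial>M) \<longlonglongrightarrow> 0"
    and g: "(\<lambda>n. \<integral>\<^sup>+x. ennreal (norm (g n x) powr p) \<partial>M) \<longlonglongrightarrow> 0"
  shows "(\<lambda>n. \<integral>\<^sup>+x. ennreal (norm (f n x + g n x) powr p) \<partial>M) \<longlonglongrightarrow> 0"
proof (rule tendsto_sandwich[OF _ _ tendsto_const])
  show "(\<lambda>n. ennreal (2 powr p) * ((\<integral>\<^sup>+x. ennreal (norm (f n x) powr p) \<partial>M)
      + (\<integral>\<^sup>+x. ennreal (norm (g n x) powr p) \<partial>M))) \<longlonglongrightarrow> 0"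
    using ennreal_tendsto_cmult[OF _ tendsto_add[OF f g], of "ennreal (2 powr p)"] by simp
qed (auto intro!: always_eventually nn_integral_norm_powr_add_le p)

lemma nn_integral_tendsto_0_AE_subseq:
  fixes f :: "nat \<Rightarrow> 'a \<Rightarrow> real"
  assumes [measurable]: "\<And>n. f n \<in> borel_measurable M" and nn: "\<And>n x. 0 \<le> f n x"
    and lim: "(\<lambda>n. \<integral>\<^sup>+x. ennreal (f n x) \<partial>M) \<longlonglongrightarrow> 0"
  obtains r :: "nat \<Rightarrow> nat" where "strict_mono r" "AE x in M. (\<lambda>n. f (r n) x) \<longlonglongrightarrow> 0"
proof -
  have "\<forall>\<^sub>F n in sequentially. (\<integral>\<^sup>+x. ennreal (f n x) \<partial>M) < 1"
    using lim by (rule order_tendstoD) simp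
  then obtain N where N: "(\<integral>\<^sup>+x. ennreal (f n x) \<partial>M) < 1" if "n \<ge> N" for n
    by (auto simp: eventually_sequentially)
  have int: "integrable M (f (n + N))" for n
    using N[of "n + N"] nn by (intro integrableI_nonneg) (auto intro: less_trans)
  have "(\<lambda>n. enn2real (\<integral>\<^sup>+x. ennreal (f (n + N) x) \<partial>M)) \<longlonglongrightarrow> 0"
    using LIMSEQ_ignore_initial_segment[OF lim, of N] by (intro tendsto_enn2real) simp_all
  then have "(\<lambda>n. \<integral>x. norm (f (n + N) x) \<partial>M) \<longlonglongrightarrow> 0"
    using nn int by (simp add: integral_eq_nn_integral)
  from tendsto_L1_AE_subseq[OF int this] obtain r where
    "strict_mono r" "AE x in M. (\<lambda>n. f (r n + N) x) \<longlonglongrightarrow> 0" by auto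
  then show ?thesis
    by (intro that[of "\<lambda>n. r n + N"]) (auto simp: strict_mono_def)
qed

lemma Lp_null_dominated:
  fixes c :: "nat \<Rightarrow> 'a \<Rightarrow> real" and V :: "'a \<Rightarrow> 'b::euclidean_space"
  assumes [measurable]: "\<And>n. c n \<in> borel_measurable M" "V \<in> borel_measurable M" and p: "0 < p"
    and c: "\<And>n x. x \<in> space M \<Longrightarrow> \<bar>c n x\<bar> \<le> B"
    and lim: "AE x in M. (\<lambda>n. c n x) \<longlonglongrightarrow> 0"
    and V: "(\<integral>\<^sup>+x. ennreal (norm (V x) powr p) \<partial>M) < \<infinity>"
  shows "(\<lambda>n. \<integral>\<^sup>+x. ennreal (norm (c n x *\<^sub>R V x) powr p) \<partial>M) \<longlonglongrightarrow> 0"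
proof -
  have "(\<lambda>n. \<integral>\<^sup>+x. ennreal (norm (c n x *\<^sub>R V x) powr p) \<partial>M) \<longlonglongrightarrow> (\<integral>\<^sup>+x. 0 \<partial>M)"
  proof (rule nn_integral_dominated_convergence[where w = "\<lambda>x. ennreal (B powr p) * ennreal (norm (V x) powr p)"])
    show "(\<integral>\<^sup>+x. ennreal (B powr p) * ennreal (norm (V x) powr p) \<partial>M) < \<infinity>"
      using V by (simp add: nn_integral_cmult ennreal_mult_less_top)
    show "AE x in M. ennreal (norm (c n x *\<^sub>R V x) powr p) \<le> ennreal (B powr p) * ennreal (norm (V x) powr p)" for n
    proof (rule AE_I2)
      fix x assume x: "x \<in> space M"
      have "\<bar>c n x\<bar> powr p \<le> B powr p"
        using c[OF x] p by (intro powr_mono2) auto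
      then show "ennreal (norm (c n x *\<^sub>R V x) powr p) \<le> ennreal (B powr p) * ennreal (norm (V x) powr p)"
        by (simp add: ennreal_mult'[symmetric] ennreal_leI powr_mult mult_right_mono)
    qed
    show "AE x in M. (\<lambda>n. ennreal (norm (c n x *\<^sub>R V x) powr p)) \<longlonglongrightarrow> 0"
      using lim
    proof eventually_elim
      case (elim x)
      have "(\<lambda>n. norm (c n x *\<^sub>R V x) powr p) \<longlonglongrightarrow> norm (0 *\<^sub>R V x) powr p"
        using p by (intro tendsto_intros tendsto_powr' elim) auto
      from tendsto_ennrealI[OF this] p show ?case by simp
    qed
  qed auto
  then show ?thesis by simp
qed

lemma nn_integral_lebesgue_on_subset:
  assumes "K \<subseteq> \<Omega>" "K \<in> sets lebesgue" "\<Omega> \<in> sets lebesgue"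
  shows "(\<integral>\<^sup>+x. f x \<partial>lebesgue_on K) = (\<integral>\<^sup>+x. f x * indicator K x \<partial>lebesgue_on \<Omega>)"
  using assms by (simp add: nn_integral_restrict_space, intro nn_integral_cong) (auto simp: indicator_def)

lemma borel_measurable_lebesgue_on_subset:
  assumes "f \<in> borel_measurable (lebesgue_on \<Omega>)" "K \<subseteq> \<Omega>"
  shows "f \<in> borel_measurable (lebesgue_on K)"
  using assms by (rule measurable_restrict_mono)

lemma nn_integral_powr_compact_support:
  fixes f :: "'a::euclidean_space \<Rightarrow> 'b::euclidean_space"
  assumes f: "continuous_on K f" and K: "compact K" "K \<subseteq> \<Omega>" "\<Omega> \<in> sets lebesgue"
    and z: "\<And>x. x \<in> \<Omega> - K \<Longrightarrow> f x = 0" and p: "0 \<le> p"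
  shows "(\<integral>\<^sup>+x. ennreal (norm (f x) powr p) \<partial>lebesgue_on \<Omega>) < \<infinity>"
proof -
  obtain B where B: "norm (f x) \<le> B" if "x \<in> K" for x
    using compact_imp_bounded[OF compact_continuous_image[OF f K(1)]] by (auto simp: bounded_iff)
  have Ks: "K \<in> sets lebesgue" using K by (simp add: lmeasurable_compact fmeasurableD)
  have "(\<integral>\<^sup>+x. ennreal (norm (f x) powr p) \<partial>lebesgue_on \<Omega>) \<le> (\<integral>\<^sup>+x. ennreal (B powr p) * indicator K x \<partial>lebesgue_on \<Omega>)"
    using B z p by (intro nn_integral_mono) (auto simp: indicator_def powr_mono2 ennreal_leI)
  also have "\<dots> = (\<integral>\<^sup>+x. ennreal (B powr p) \<partial>lebesgue_on K)"
    using K Ks by (intro nn_integral_lebesgue_on_subset[symmetric]) auto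
  also have "\<dots> < \<infinity>"
    using K Ks lmeasurable_compact[OF K(1)] by (auto simp: emeasure_restrict_space ennreal_mult_less_top fmeasurable_def)
  finally show ?thesis .
qed

section \<open>Products and compositions in the Grushin--Sobolev space\<close>

lemma C01_D:
  assumes "u \<in> C01 \<Omega>"
  shows "Ck 1 u" "compact (closure {x. u x \<noteq> 0})" "closure {x. u x \<noteq> 0} \<subseteq> \<Omega>"
  using assms by (auto simp: C01_def compact_support_in_def)

lemma C01_support_mono:
  assumes u: "u \<in> C01 \<Omega>" and w: "Ck 1 w" "\<And>x. u x = 0 \<Longrightarrow> w x = 0"
  shows "w \<in> C01 \<Omega>"
proof -
  have "closure {x. w x \<noteq> 0} \<subseteq> closure {x. u x \<noteq> 0}"
    using w(2) by (intro closure_mono) blast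
  moreover from this have "compact (closure {x. w x \<noteq> 0})"
    using compact_Int_closed[OF C01_D(2)[OF u] closed_closure[of "{x. w x \<noteq> 0}"]]
    by (simp only: inf.absorb2)
  ultimately show ?thesis
    using w(1) C01_D(3)[OF u] unfolding C01_def compact_support_in_def by blast
qed

lemma borel_measurable_continuous_lebesgue_on:
  fixes f :: "'a::euclidean_space \<Rightarrow> 'b::euclidean_space"
  assumes "continuous_on UNIV f" "\<Omega> \<in> sets lebesgue"
  shows "f \<in> borel_measurable (lebesgue_on \<Omega>)"
  using continuous_on_subset[OF assms(1), of \<Omega>] assms(2)
  by (simp add: continuous_imp_measurable_on_sets_lebesgue)

lemma compact_in_sets_lebesgue: "compact K \<Longrightarrow> K \<in> sets lebesgue"
  by (simp add: lmeasurable_compact fmeasurableD)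

lemma S1p_grad_Lp:
  assumes \<Omega>: "\<Omega> \<in> sets lebesgue" and p: "0 \<le> p" and S: "S1p p \<Omega> v V"
  shows "(\<integral>\<^sup>+x. ennreal (norm (V x) powr p) \<partial>lebesgue_on \<Omega>) < \<infinity>"
proof -
  from S obtain w where [measurable]: "V \<in> borel_measurable (lebesgue_on \<Omega>)"
    and w: "\<And>n. w n \<in> C01 \<Omega>"
    and lim: "(\<lambda>n. \<integral>\<^sup>+ x. ennreal (norm (grushin_grad (w n) x - V x) powr p) \<partial>lebesgue_on \<Omega>) \<longlonglongrightarrow> 0"
    unfolding S1p_def by blast
  have "\<forall>\<^sub>F n in sequentially. (\<integral>\<^sup>+ x. ennreal (norm (grushin_grad (w n) x - V x) powr p) \<partial>lebesgue_on \<Omega>) < 1"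
    using lim by (rule order_tendstoD) simp
  then obtain n where n: "(\<integral>\<^sup>+ x. ennreal (norm (grushin_grad (w n) x - V x) powr p) \<partial>lebesgue_on \<Omega>) < 1"
    by (auto simp: eventually_sequentially)
  note c = Ck_1_imp_continuous_grad[OF C01_D(1)[OF w[of n]]]
  have [measurable]: "grushin_grad (w n) \<in> borel_measurable (lebesgue_on \<Omega>)"
    by (rule borel_measurable_continuous_lebesgue_on[OF c \<Omega>])
  have fin: "(\<integral>\<^sup>+ x. ennreal (norm (grushin_grad (w n) x) powr p) \<partial>lebesgue_on \<Omega>) < \<infinity>"
    using C01_D[OF w[of n]] \<Omega> p
    by (intro nn_integral_powr_compact_support[OF continuous_on_subset[OF c]])
       (auto intro: grushin_grad_zero_outside_support)
  have "(\<integral>\<^sup>+x. ennreal (norm (V x) powr p) \<partial>lebesgue_on \<Omega>)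
      = (\<integral>\<^sup>+x. ennreal (norm (grushin_grad (w n) x + (V x - grushin_grad (w n) x)) powr p) \<partial>lebesgue_on \<Omega>)"
    by simp
  also have "\<dots> \<le> ennreal (2 powr p) * ((\<integral>\<^sup>+ x. ennreal (norm (grushin_grad (w n) x) powr p) \<partial>lebesgue_on \<Omega>)
      + (\<integral>\<^sup>+ x. ennreal (norm (V x - grushin_grad (w n) x) powr p) \<partial>lebesgue_on \<Omega>))"
    using p by (intro nn_integral_norm_powr_add_le) auto
  also have "\<dots> < \<infinity>"
    using n fin by (subst norm_minus_commute) (auto simp: ennreal_mult_less_top intro: less_trans)
  finally show ?thesis .
qed

lemma S1p_local_Lp:
  assumes \<Omega>: "\<Omega> \<in> sets lebesgue" and p: "0 \<le> p" and S: "S1p p \<Omega> v V" and K: "compact K" "K \<subseteq> \<Omega>"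
  shows "(\<integral>\<^sup>+x. ennreal (\<bar>v x\<bar> powr p) \<partial>lebesgue_on K) < \<infinity>"
proof -
  from S K obtain w where vm: "v \<in> borel_measurable (lebesgue_on \<Omega>)"
    and w: "\<And>n. w n \<in> C01 \<Omega>"
    and lim: "(\<lambda>n. \<integral>\<^sup>+ x. ennreal (\<bar>w n x - v x\<bar> powr p) \<partial>lebesgue_on K) \<longlonglongrightarrow> 0"
    unfolding S1p_def by blast
  have Ks: "K \<in> sets lebesgue" using K by (rule_tac compact_in_sets_lebesgue)
  have [measurable]: "v \<in> borel_measurable (lebesgue_on K)"
    using vm K(2) by (rule borel_measurable_lebesgue_on_subset)
  have "\<forall>\<^sub>F n in sequentially. (\<integral>\<^sup>+ x. ennreal (\<bar>w n x - v x\<bar> powr p) \<partial>lebesgue_on K) < 1"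
    using lim by (rule order_tendstoD) simp
  then obtain n where n: "(\<integral>\<^sup>+ x. ennreal (\<bar>w n x - v x\<bar> powr p) \<partial>lebesgue_on K) < 1"
    by (auto simp: eventually_sequentially)
  note c = Ck_1_imp_continuous[OF C01_D(1)[OF w[of n]]]
  have [measurable]: "w n \<in> borel_measurable (lebesgue_on K)"
    by (rule borel_measurable_continuous_lebesgue_on[OF c Ks])
  have fin: "(\<integral>\<^sup>+ x. ennreal (norm (w n x) powr p) \<partial>lebesgue_on K) < \<infinity>"
    using K Ks p by (intro nn_integral_powr_compact_support[OF continuous_on_subset[OF c], of K]) auto
  have "(\<integral>\<^sup>+x. ennreal (\<bar>v x\<bar> powr p) \<partial>lebesgue_on K)
      = (\<integral>\<^sup>+x. ennreal (norm (w n x + (v x - w n x)) powr p) \<partial>lebesgue_on K)"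
    by simp
  also have "\<dots> \<le> ennreal (2 powr p) * ((\<integral>\<^sup>+ x. ennreal (norm (w n x) powr p) \<partial>lebesgue_on K)
      + (\<integral>\<^sup>+ x. ennreal (norm (v x - w n x) powr p) \<partial>lebesgue_on K))"
    using p by (intro nn_integral_norm_powr_add_le) auto
  also have "\<dots> < \<infinity>"
    using n fin by (subst norm_minus_commute) (auto simp: ennreal_mult_less_top intro: less_trans)
  finally show ?thesis .
qed

lemma bounded_derivative_lipschitz:
  fixes G g :: "real \<Rightarrow> real"
  assumes "\<And>t. (G has_real_derivative g t) (at t)" "\<And>t. \<bar>g t\<bar> \<le> L"
  shows "\<bar>G a - G b\<bar> \<le> L * \<bar>a - b\<bar>"
  using field_differentiable_bound[of UNIV G g L a b] assms by simp

lemma C01_bounded: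
  assumes "u \<in> C01 \<Omega>"
  obtains B where "0 \<le> B" "\<And>x. \<bar>u x\<bar> \<le> B" "\<And>x. norm (grushin_grad u x) \<le> B"
proof -
  let ?K = "closure {x. u x \<noteq> 0}"
  note u = C01_D[OF assms]
  have "compact ((\<lambda>x. (u x, grushin_grad u x)) ` ?K)"
    by (rule compact_continuous_image[OF continuous_on_subset[OF continuous_on_Pair[OF
        Ck_1_imp_continuous[OF u(1)] Ck_1_imp_continuous_grad[OF u(1)]] subset_UNIV] u(2)])
  from compact_imp_bounded[OF this] obtain B
    where "\<forall>y \<in> (\<lambda>x. (u x, grushin_grad u x)) ` ?K. norm y \<le> B"
    unfolding bounded_iff by blast
  then have B: "norm (u x, grushin_grad u x) \<le> B" if "x \<in> ?K" for x
    using that by blast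
  have 1: "\<bar>u x\<bar> \<le> max 0 B" for x
  proof (cases "x \<in> ?K")
    case True
    then show ?thesis using B[OF True] norm_fst_le[of "u x" "grushin_grad u x"] by simp
  next
    case False
    then have "u x = 0" using closure_subset[of "{x. u x \<noteq> 0}"] by auto
    then show ?thesis by simp
  qed
  have 2: "norm (grushin_grad u x) \<le> max 0 B" for x
  proof (cases "x \<in> ?K")
    case True
    then show ?thesis using B[OF True] norm_snd_le[of "grushin_grad u x" "u x"] by simp
  next
    case False
    then show ?thesis by (simp add: grushin_grad_zero_outside_support)
  qed
  show ?thesis by (rule that[OF _ 1 2]) simp
qed

lemma S1p_mult_comp:
  assumes \<Omega>: "\<Omega> \<in> sets lebesgue" and p: "0 < p" and S: "S1p p \<Omega> v V" and \<zeta>: "\<zeta> \<in> C01 \<Omega>"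
    and G: "\<And>t. (G has_real_derivative g t) (at t)" and g: "continuous_on UNIV g"
    and L: "\<And>t. \<bar>g t\<bar> \<le> L"
  shows "S1p p \<Omega> (\<lambda>x. \<zeta> x * G (v x))
    (\<lambda>x. G (v x) *\<^sub>R grushin_grad \<zeta> x + (\<zeta> x * g (v x)) *\<^sub>R V x)"
proof -
  let ?M = "lebesgue_on \<Omega>"
  define K where "K = closure {x. \<zeta> x \<noteq> 0}"
  from \<zeta> have \<zeta>1: "Ck 1 \<zeta>" and K: "compact K" "K \<subseteq> \<Omega>"
    unfolding K_def by (auto dest: C01_D)
  have Ks: "K \<in> sets lebesgue" by (rule compact_in_sets_lebesgue[OF K(1)])
  have KM: "K \<in> sets ?M" using K Ks \<Omega> by (simp add: sets_restrict_space_iff)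
  have zK: "\<zeta> x = 0" "grushin_grad \<zeta> x = 0" if "x \<notin> K" for x
    using that closure_subset[of "{x. \<zeta> x \<noteq> 0}"] grushin_grad_zero_outside_support
    by (auto simp: K_def)
  obtain B where B: "0 \<le> B" "\<And>x. \<bar>\<zeta> x\<bar> \<le> B" "\<And>x. norm (grushin_grad \<zeta> x) \<le> B"
    by (rule C01_bounded[OF \<zeta>]) blast
  have L0: "0 \<le> L" using L[of 0] by linarith
  have Lip: "\<bar>G a - G b\<bar> \<le> L * \<bar>a - b\<bar>" for a b
    by (rule bounded_derivative_lipschitz[OF G L])
  have cG: "continuous_on UNIV G"
    using G by (auto simp: continuous_on_eq_continuous_at intro: DERIV_isCont)
  have [measurable]: "G \<in> borel_measurable borel" "g \<in> borel_measurable borel"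
    using cG g by (auto intro: borel_measurable_continuous_onI)
  have [measurable]: "\<zeta> \<in> borel_measurable ?M" "grushin_grad \<zeta> \<in> borel_measurable ?M"
    by (rule borel_measurable_continuous_lebesgue_on[OF _ \<Omega>] Ck_1_imp_continuous
        Ck_1_imp_continuous_grad \<zeta>1)+
  from S obtain w where [measurable]: "v \<in> borel_measurable ?M" "V \<in> borel_measurable ?M"
    and w: "\<And>n. w n \<in> C01 \<Omega>"
    and limV: "(\<lambda>n. \<integral>\<^sup>+ x. ennreal (norm (grushin_grad (w n) x - V x) powr p) \<partial>?M) \<longlonglongrightarrow> 0"
    and limv: "\<And>K. compact K \<Longrightarrow> K \<subseteq> \<Omega> \<Longrightarrow>
      (\<lambda>n. \<integral>\<^sup>+ x. ennreal (\<bar>w n x - v x\<bar> powr p) \<partial>lebesgue_on K) \<longlonglongrightarrow> 0"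
    unfolding S1p_def by blast
  note wC = C01_D[OF w]
  have [measurable]: "w n \<in> borel_measurable ?M" "grushin_grad (w n) \<in> borel_measurable ?M" for n
    by (rule borel_measurable_continuous_lebesgue_on[OF _ \<Omega>] Ck_1_imp_continuous
        Ck_1_imp_continuous_grad wC(1))+
  note [measurable] = KM
  have limK: "(\<lambda>n. \<integral>\<^sup>+ x. ennreal (\<bar>w n x - v x\<bar> powr p * indicator K x) \<partial>?M) \<longlonglongrightarrow> 0"
    using limv[OF K] K Ks \<Omega> by (simp add: nn_integral_lebesgue_on_subset ennreal_mult' ennreal_indicator)
  \<comment> \<open>As \<open>g\<close> is merely continuous, \<open>(g (w n) - g v) V \<longrightarrow> 0\<close> in \<open>L\<^sup>p\<close> needs pointwise convergence.\<close>
  obtain r :: "nat \<Rightarrow> nat" where r: "strict_mono r"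
    "AE x in ?M. (\<lambda>n. \<bar>w (r n) x - v x\<bar> powr p * indicator K x) \<longlonglongrightarrow> 0"
    by (rule nn_integral_tendsto_0_AE_subseq[OF _ _ limK]) auto
  have AEK: "AE x in ?M. x \<in> K \<longrightarrow> (\<lambda>n. w (r n) x) \<longlonglongrightarrow> v x"
    using r(2)
  proof eventually_elim
    case (elim x)
    show ?case
    proof
      assume "x \<in> K"
      with elim have "(\<lambda>n. \<bar>w (r n) x - v x\<bar> powr p) \<longlonglongrightarrow> 0" by simp
      then have "(\<lambda>n. (\<bar>w (r n) x - v x\<bar> powr p) powr (1 / p)) \<longlonglongrightarrow> 0 powr (1 / p)"
        using p by (intro tendsto_powr' tendsto_const) auto
      then have "(\<lambda>n. \<bar>w (r n) x - v x\<bar>) \<longlonglongrightarrow> 0"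
        using p by (simp add: powr_powr)
      then show "(\<lambda>n. w (r n) x) \<longlonglongrightarrow> v x"
        by (simp add: tendsto_rabs_zero_iff LIM_zero_iff)
    qed
  qed
  define \<psi> where "\<psi> n x = \<zeta> x * G (w (r n) x)" for n x
  have "\<psi> n \<in> C01 \<Omega>" for n
    unfolding \<psi>_def[abs_def]
    by (rule C01_support_mono[OF \<zeta> Ck_1_mult_comp[OF \<zeta>1 wC(1) G g]]) auto
  moreover have "(\<lambda>n. \<integral>\<^sup>+ x. ennreal (norm (grushin_grad (\<psi> n) x
      - (G (v x) *\<^sub>R grushin_grad \<zeta> x + (\<zeta> x * g (v x)) *\<^sub>R V x)) powr p) \<partial>?M) \<longlonglongrightarrow> 0"
  proof -
    have eq: "grushin_grad (\<psi> n) x - (G (v x) *\<^sub>R grushin_grad \<zeta> x + (\<zeta> x * g (v x)) *\<^sub>R V x)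
      = (G (w (r n) x) - G (v x)) *\<^sub>R grushin_grad \<zeta> x
        + ((\<zeta> x * g (w (r n) x)) *\<^sub>R (grushin_grad (w (r n)) x - V x)
        + (\<zeta> x * (g (w (r n) x) - g (v x))) *\<^sub>R V x)" for n x
      unfolding \<psi>_def[abs_def] grushin_grad_mult_comp[OF \<zeta>1 wC(1) G g]
      by (simp add: algebra_simps)
    show ?thesis
      unfolding eq
    proof (intro Lp_null_add)
      show "(\<lambda>n. \<integral>\<^sup>+ x. ennreal (norm ((G (w (r n) x) - G (v x)) *\<^sub>R grushin_grad \<zeta> x) powr p) \<partial>?M) \<longlonglongrightarrow> 0"
      proof (rule Lp_null_comparison[where a = "\<lambda>n x. (w (r n) x - v x) * indicator K x" and B = "L * B"])
        show "norm ((G (w (r n) x) - G (v x)) *\<^sub>R grushin_grad \<zeta> x)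
          \<le> L * B * norm ((w (r n) x - v x) * indicator K x)" for n x
        proof (cases "x \<in> K")
          case True
          have "\<bar>G (w (r n) x) - G (v x)\<bar> * norm (grushin_grad \<zeta> x) \<le> (L * \<bar>w (r n) x - v x\<bar>) * B"
            using Lip B L0 by (intro mult_mono) auto
          with True show ?thesis by (simp add: mult_ac)
        qed (simp add: zK)
        show "(\<lambda>n. \<integral>\<^sup>+ x. ennreal (norm ((w (r n) x - v x) * indicator K x) powr p) \<partial>?M) \<longlonglongrightarrow> 0"
          using LIMSEQ_subseq_LIMSEQ[OF limK r(1)]
          by (rule Lim_transform_eventually) (auto simp: o_def abs_mult powr_mult indicator_def intro!: always_eventually nn_integral_cong)
      qed (use p B L0 in auto)
      show "(\<lambda>n. \<integral>\<^sup>+ x. ennreal (norm ((\<zeta> x * g (w (r n) x)) *\<^sub>R (grushin_grad (w (r n)) x - V x)) powr p) \<partial>?M) \<longlonglongrightarrow> 0"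
      proof (rule Lp_null_comparison[where a = "\<lambda>n x. grushin_grad (w (r n)) x - V x" and B = "B * L"])
        show "norm ((\<zeta> x * g (w (r n) x)) *\<^sub>R (grushin_grad (w (r n)) x - V x))
          \<le> B * L * norm (grushin_grad (w (r n)) x - V x)" for n x
        proof -
          have "\<bar>\<zeta> x * g (w (r n) x)\<bar> \<le> B * L"
            unfolding abs_mult using B L by (intro mult_mono) auto
          then show ?thesis by (simp add: mult_right_mono)
        qed
        show "(\<lambda>n. \<integral>\<^sup>+ x. ennreal (norm (grushin_grad (w (r n)) x - V x) powr p) \<partial>?M) \<longlonglongrightarrow> 0"
          using LIMSEQ_subseq_LIMSEQ[OF limV r(1)] by (simp add: o_def)
      qed (use p B L0 in auto)
      show "(\<lambda>n. \<integral>\<^sup>+ x. ennreal (norm ((\<zeta> x * (g (w (r n) x) - g (v x))) *\<^sub>R V x) powr p) \<partial>?M) \<longlonglongrightarrow> 0"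
      proof (rule Lp_null_dominated[where B = "B * (2 * L)"])
        show "\<bar>\<zeta> x * (g (w (r n) x) - g (v x))\<bar> \<le> B * (2 * L)" for n x
          unfolding abs_mult using B L[of "w (r n) x"] L[of "v x"] by (intro mult_mono) auto
        show "AE x in ?M. (\<lambda>n. \<zeta> x * (g (w (r n) x) - g (v x))) \<longlonglongrightarrow> 0"
          using AEK
        proof eventually_elim
          case (elim x)
          show ?case
          proof (cases "x \<in> K")
            case True
            have "isCont g (v x)" using g by (simp add: continuous_on_eq_continuous_at)
            with True elim have "(\<lambda>n. g (w (r n) x)) \<longlonglongrightarrow> g (v x)"
              by (auto intro: isCont_tendsto_compose)
            then have "(\<lambda>n. \<zeta> x * (g (w (r n) x) - g (v x))) \<longlonglongrightarrow> \<zeta> x * (g (v x) - g (v x))"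
              by (intro tendsto_intros)
            then show ?thesis by simp
          qed (simp add: zK)
        qed
        show "(\<integral>\<^sup>+x. ennreal (norm (V x) powr p) \<partial>?M) < \<infinity>"
          using \<Omega> p S by (intro S1p_grad_Lp) auto
      qed (use p in auto)
    qed (use p in auto)
  qed
  moreover have "(\<lambda>n. \<integral>\<^sup>+ x. ennreal (\<bar>\<psi> n x - \<zeta> x * G (v x)\<bar> powr p) \<partial>lebesgue_on K') \<longlonglongrightarrow> 0"
    if K': "compact K'" "K' \<subseteq> \<Omega>" for K'
  proof -
    have "(\<lambda>n. \<integral>\<^sup>+ x. ennreal (norm (\<psi> n x - \<zeta> x * G (v x)) powr p) \<partial>lebesgue_on K') \<longlonglongrightarrow> 0"
    proof (rule Lp_null_comparison[where a = "\<lambda>n x. w (r n) x - v x" and B = "B * L"])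
      show "(\<lambda>x. w (r n) x - v x) \<in> borel_measurable (lebesgue_on K')" for n
        by (rule borel_measurable_lebesgue_on_subset[OF _ K'(2)]) measurable
      show "norm (\<psi> n x - \<zeta> x * G (v x)) \<le> B * L * norm (w (r n) x - v x)" for n x
      proof -
        have "\<bar>\<zeta> x\<bar> * \<bar>G (w (r n) x) - G (v x)\<bar> \<le> B * (L * \<bar>w (r n) x - v x\<bar>)"
          using Lip B L0 by (intro mult_mono) auto
        then show ?thesis by (simp add: \<psi>_def right_diff_distrib[symmetric] abs_mult mult.assoc)
      qed
      show "(\<lambda>n. \<integral>\<^sup>+ x. ennreal (norm (w (r n) x - v x) powr p) \<partial>lebesgue_on K') \<longlonglongrightarrow> 0"
        using LIMSEQ_subseq_LIMSEQ[OF limv[OF K'] r(1)] by (simp add: o_def)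
    qed (use p B L0 in auto)
    then show ?thesis by simp
  qed
  ultimately show ?thesis
    unfolding S1p_def by (intro conjI exI[of _ \<psi>]) (auto)
qed

section \<open>The Caccioppoli inequality for truncated powers\<close>

lemma scaled_Young_powr:
  fixes p g G \<phi> N D :: real
  assumes p: "1 < p" and g: "0 < g" and nn: "0 \<le> G" "0 \<le> \<phi>" "0 \<le> N" "0 \<le> D"
  shows "p * (\<phi> powr (p - 1) * N powr (p - 1) * G * D)
    \<le> (1 - 1 / p) * (\<phi> powr p * g * N powr p) + p powr (p - 1) * (g * (G / g) powr p * D powr p)"
proof -
  define h where "h = G / g"
  have h: "0 \<le> h" "G = g * h"
    using g nn by (auto simp: h_def)
  have "(\<phi> * N) powr (p - 1) * (p * h * D)
      \<le> ((\<phi> * N) powr (p - 1)) powr (p / (p - 1)) / (p / (p - 1)) + (p * h * D) powr p / p"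
    using p h nn by (intro Youngs_inequality) (auto simp: field_simps)
  also have "((\<phi> * N) powr (p - 1)) powr (p / (p - 1)) / (p / (p - 1)) = (1 - 1 / p) * (\<phi> powr p * N powr p)"
  proof -
    have "(p - 1) * (p / (p - 1)) = p" "1 / (p / (p - 1)) = 1 - 1 / p"
      using p by (simp_all add: field_simps)
    then show ?thesis
      using nn by (metis powr_powr powr_mult times_divide_eq_left mult_1)
  qed
  also have "(p * h * D) powr p / p = p powr (p - 1) * (h powr p * D powr p)"
    using p h nn by (simp add: powr_mult powr_diff)
  finally have "g * ((\<phi> * N) powr (p - 1) * (p * h * D))
      \<le> g * ((1 - 1 / p) * (\<phi> powr p * N powr p) + p powr (p - 1) * (h powr p * D powr p))"
    using g by (intro mult_left_mono) auto
  then show ?thesis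
    using nn unfolding h_def[symmetric] h(2) by (simp add: powr_mult algebra_simps)
qed

lemma C01_powr:
  assumes p: "1 < p" and \<phi>: "\<phi> \<in> C01 \<Omega>" and nn: "\<And>x. 0 \<le> \<phi> x"
  shows "(\<lambda>x. \<phi> x powr p) \<in> C01 \<Omega>"
    and "grushin_grad (\<lambda>x. \<phi> x powr p) x = (p * \<phi> x powr (p - 1)) *\<^sub>R grushin_grad \<phi> x"
proof -
  have eq: "(\<lambda>x. \<phi> x powr p) = (\<lambda>x. 1 * \<bar>\<phi> x\<bar> powr p)"
    using nn by simp
  have cont: "continuous_on UNIV (\<lambda>t. p * \<bar>t\<bar> powr (p - 1) * sgn t)"
    using continuous_on_mult_left[OF continuous_abs_powr_sgn[of "p - 1"], of p] p
    by (simp add: mult.assoc)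
  note \<phi>1 = C01_D(1)[OF \<phi>]
  show "(\<lambda>x. \<phi> x powr p) \<in> C01 \<Omega>"
    unfolding eq
    by (rule C01_support_mono[OF \<phi> Ck_1_mult_comp[OF Ck_1_const \<phi>1 has_real_derivative_abs_powr[OF p] cont]]) simp
  have c: "grushin_grad (\<lambda>x. 1) x = 0"
    by (simp add: grushin_grad_def partial1_def partial2_def zero_prod_def)
  have "\<bar>\<phi> x\<bar> powr (p - 1) * sgn (\<phi> x) = \<phi> x powr (p - 1)"
    using nn[of x] by (cases "\<phi> x = 0") auto
  then show "grushin_grad (\<lambda>x. \<phi> x powr p) x = (p * \<phi> x powr (p - 1)) *\<^sub>R grushin_grad \<phi> x"
    unfolding eq grushin_grad_mult_comp[OF Ck_1_const \<phi>1 has_real_derivative_abs_powr[OF p] cont] c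
    by (simp add: mult.assoc)
qed

lemma truncated_Caccioppoli:
  fixes \<Omega> :: "plane set" and p lam :: real and v \<phi> :: "plane \<Rightarrow> real" and V :: "plane \<Rightarrow> plane"
    and G g :: "real \<Rightarrow> real"
  defines "a \<equiv> \<lambda>x. \<phi> x powr p * g (v x) * norm (V x) powr p"
    and "b \<equiv> \<lambda>x. g (v x) * (G (v x) / g (v x)) powr p * norm (grushin_grad \<phi> x) powr p"
    and "c \<equiv> \<lambda>x. v x powr (p - 1) * G (v x) * \<phi> x powr p"
  assumes \<Omega>: "\<Omega> \<in> sets lebesgue" and p: "1 < p" and sub: "grushin_subsolution p lam \<Omega> v V"
    and pos: "AE x in lebesgue_on \<Omega>. 0 < v x"
    and \<phi>: "\<phi> \<in> C01 \<Omega>" and nn: "\<And>x. 0 \<le> \<phi> x"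
    and G: "\<And>t. (G has_real_derivative g t) (at t)" and g: "continuous_on UNIV g"
    and L: "\<And>t. \<bar>g t\<bar> \<le> L" and gpos: "\<And>t. 0 < t \<Longrightarrow> 0 < g t"
    and GC: "\<And>t. 0 < t \<Longrightarrow> 0 \<le> G t \<and> G t \<le> C * t * g t"
  shows "integrable (lebesgue_on \<Omega>) a" "integrable (lebesgue_on \<Omega>) b" "integrable (lebesgue_on \<Omega>) c"
    and "(\<integral>x. a x \<partial>lebesgue_on \<Omega>) \<le> p powr p * (\<integral>x. b x \<partial>lebesgue_on \<Omega>)
      + lam * p * (\<integral>x. c x \<partial>lebesgue_on \<Omega>)"
proof -
  let ?M = "lebesgue_on \<Omega>"
  let ?D = "\<lambda>x. norm (grushin_grad \<phi> x)"
  define K where "K = closure {x. \<phi> x \<noteq> 0}"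
  from \<phi> have \<phi>1: "Ck 1 \<phi>" and K: "compact K" "K \<subseteq> \<Omega>"
    unfolding K_def by (auto dest: C01_D)
  have Ks: "K \<in> sets lebesgue" by (rule compact_in_sets_lebesgue[OF K(1)])
  have [measurable]: "K \<in> sets ?M" using K Ks \<Omega> by (simp add: sets_restrict_space_iff)
  have zK: "\<phi> x = 0" "grushin_grad \<phi> x = 0" if "x \<notin> K" for x
    using that closure_subset[of "{x. \<phi> x \<noteq> 0}"] grushin_grad_zero_outside_support
    by (auto simp: K_def)
  obtain B where B: "0 \<le> B" "\<And>x. \<bar>\<phi> x\<bar> \<le> B" "\<And>x. norm (grushin_grad \<phi> x) \<le> B"
    by (rule C01_bounded[OF \<phi>]) blast
  have L0: "0 \<le> L" using L[of 0] by linarith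
  have C0: "0 \<le> C"
  proof -
    have "0 \<le> C * g 1" using GC[of 1] by simp
    then show ?thesis using gpos[of 1] by (simp add: zero_le_mult_iff)
  qed
  have GL: "G t \<le> C * L * t" if "0 < t" for t
  proof -
    have "C * t * g t \<le> C * t * L"
      using C0 that L[of t] by (intro mult_left_mono) auto
    with GC[OF that] show ?thesis by (simp add: mult_ac)
  qed
  have cG: "continuous_on UNIV G"
    using G by (auto simp: continuous_on_eq_continuous_at intro: DERIV_isCont)
  have [measurable]: "G \<in> borel_measurable borel" "g \<in> borel_measurable borel"
    using cG g by (auto intro: borel_measurable_continuous_onI)
  have [measurable]: "\<phi> \<in> borel_measurable ?M" "grushin_grad \<phi> \<in> borel_measurable ?M"
    by (rule borel_measurable_continuous_lebesgue_on[OF _ \<Omega>] Ck_1_imp_continuous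
        Ck_1_imp_continuous_grad \<phi>1)+
  from sub have S: "S1p p \<Omega> v V" by (simp add: grushin_subsolution_def)
  then have [measurable]: "v \<in> borel_measurable ?M" "V \<in> borel_measurable ?M"
    by (auto simp: S1p_def)
  have IV: "integrable ?M (\<lambda>x. norm (V x) powr p)"
    using S1p_grad_Lp[OF \<Omega> _ S] p by (intro integrableI_nonneg) auto
  have Iv: "integrable ?M (\<lambda>x. \<bar>v x\<bar> powr p * indicator K x)"
  proof (rule integrableI_nonneg)
    show "(\<integral>\<^sup>+ x. ennreal (\<bar>v x\<bar> powr p * indicator K x) \<partial>?M) < \<infinity>"
      using S1p_local_Lp[OF \<Omega> _ S K] p K Ks \<Omega>
      by (simp add: nn_integral_lebesgue_on_subset ennreal_mult' ennreal_indicator)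
  qed auto
  show Ia: "integrable ?M a"
  proof (rule Bochner_Integration.integrable_bound)
    show "integrable ?M (\<lambda>x. B powr p * L * norm (V x) powr p)"
      using IV by simp
    show "AE x in ?M. norm (a x) \<le> norm (B powr p * L * norm (V x) powr p)"
    proof (rule AE_I2)
      fix x
      have "\<phi> x powr p * \<bar>g (v x)\<bar> \<le> B powr p * L"
        using B(2)[of x] nn[of x] p L L0 by (intro mult_mono powr_mono2) auto
      then show "norm (a x) \<le> norm (B powr p * L * norm (V x) powr p)"
        using L0 by (simp add: a_def abs_mult mult_right_mono)
    qed
  qed (simp add: a_def)
  show Ib: "integrable ?M b"
  proof (rule Bochner_Integration.integrable_bound)
    show "integrable ?M (\<lambda>x. L * C powr p * B powr p * (\<bar>v x\<bar> powr p * indicator K x))"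
      using Iv by simp
    show "AE x in ?M. norm (b x) \<le> norm (L * C powr p * B powr p * (\<bar>v x\<bar> powr p * indicator K x))"
      using pos
    proof eventually_elim
      case (elim x)
      have "(G (v x) / g (v x)) powr p \<le> (C * v x) powr p"
        using GC[OF elim] gpos[OF elim] p by (intro powr_mono2) (auto simp: field_simps)
      also have "\<dots> = C powr p * v x powr p" using C0 elim by (simp add: powr_mult)
      finally have 1: "(G (v x) / g (v x)) powr p \<le> C powr p * v x powr p" .
      have 2: "?D x powr p \<le> B powr p * indicator K x"
        using B(3)[of x] p zK(2)[of x] by (cases "x \<in> K") (auto intro: powr_mono2)
      have "b x \<le> L * (C powr p * v x powr p) * (B powr p * indicator K x)"
        unfolding b_def using 1 2 L[of "v x"] gpos[OF elim] L0 by (intro mult_mono) auto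
      moreover have "0 \<le> b x" unfolding b_def using gpos[OF elim] by simp
      ultimately show ?case using L0 elim by (simp add: abs_mult mult_ac)
    qed
  qed (simp add: b_def)
  let ?\<psi> = "\<lambda>x. \<phi> x powr p * G (v x)"
  have AEc: "AE x in ?M. \<bar>v x\<bar> powr (p - 2) * v x * ?\<psi> x = c x"
    using pos
  proof eventually_elim
    case (elim x)
    have "\<bar>v x\<bar> powr (p - 2) * v x = v x powr (p - 1)"
      using elim by (simp add: powr_diff power2_eq_square field_simps)
    then show ?case by (simp add: c_def mult_ac)
  qed
  show Ic: "integrable ?M c"
  proof (rule Bochner_Integration.integrable_bound)
    show "integrable ?M (\<lambda>x. C * L * B powr p * (\<bar>v x\<bar> powr p * indicator K x))"
      using Iv by simp
    show "AE x in ?M. norm (c x) \<le> norm (C * L * B powr p * (\<bar>v x\<bar> powr p * indicator K x))"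
      using pos
    proof eventually_elim
      case (elim x)
      have 2: "\<phi> x powr p \<le> B powr p * indicator K x"
        using B(2)[of x] nn[of x] p zK(1)[of x] by (cases "x \<in> K") (auto intro: powr_mono2)
      have "c x \<le> v x powr (p - 1) * (C * L * v x) * (B powr p * indicator K x)"
        unfolding c_def using 2 GL[OF elim] GC[OF elim] by (intro mult_mono) auto
      also have "\<dots> = C * L * B powr p * (\<bar>v x\<bar> powr p * indicator K x)"
        using elim by (simp add: powr_diff)
      finally show ?case
        using L0 C0 GC[OF elim] by (simp add: abs_mult c_def)
    qed
  qed (simp add: c_def)
  define \<Psi> where "\<Psi> = (\<lambda>x. G (v x) *\<^sub>R grushin_grad (\<lambda>x. \<phi> x powr p) x + (\<phi> x powr p * g (v x)) *\<^sub>R V x)"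
  let ?T = "\<lambda>x. norm (V x) powr (p - 2) * (V x \<bullet> \<Psi> x)"
  have S\<psi>: "S1p p \<Omega> ?\<psi> \<Psi>"
    unfolding \<Psi>_def using p S1p_mult_comp[OF \<Omega> _ S C01_powr(1)[OF p \<phi> nn] G g L] by simp
  have "(\<integral>x. ?T x \<partial>?M) - lam * (\<integral>x. \<bar>v x\<bar> powr (p - 2) * v x * ?\<psi> x \<partial>?M) \<le> 0"
  proof -
    have "integrable ?M (\<lambda>x. \<bar>v x\<bar> powr (p - 2) * v x * ?\<psi> x)"
      using AEc Ic by (subst integrable_cong_AE[where g = c]) (auto simp: c_def)
    then have "integrable ?M (\<lambda>x. lam * (\<bar>v x\<bar> powr (p - 2) * v x * ?\<psi> x))"
      by (rule integrable_mult_right)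
    moreover have "AE x in ?M. 0 \<le> ?\<psi> x"
      using pos by eventually_elim (use GC in simp)
    ultimately show ?thesis
      using sub S\<psi> unfolding grushin_subsolution_def by blast
  qed
  moreover have "(\<integral>x. \<bar>v x\<bar> powr (p - 2) * v x * ?\<psi> x \<partial>?M) = (\<integral>x. c x \<partial>?M)"
    using AEc by (intro integral_cong_AE) (auto simp: c_def)
  ultimately have Tc: "(\<integral>x. ?T x \<partial>?M) \<le> lam * (\<integral>x. c x \<partial>?M)" by simp
  have AET: "AE x in ?M. \<bar>?T x - a x\<bar> \<le> (1 - 1 / p) * a x + p powr (p - 1) * b x"
    using pos
  proof eventually_elim
    case (elim x)
    have N: "norm (V x) powr (p - 2) * (V x \<bullet> V x) = norm (V x) powr p"
      by (cases "V x = 0") (auto simp: powr_diff dot_square_norm)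
    have N1: "norm (V x) powr (p - 2) * norm (V x) = norm (V x) powr (p - 1)"
      by (cases "V x = 0") (auto simp: powr_diff power2_eq_square)
    have T: "?T x - a x = p * \<phi> x powr (p - 1) * G (v x) * (norm (V x) powr (p - 2) * (V x \<bullet> grushin_grad \<phi> x))"
      unfolding \<Psi>_def C01_powr(2)[OF p \<phi> nn] a_def N[symmetric]
      by (simp add: inner_add_right algebra_simps)
    have "\<bar>norm (V x) powr (p - 2) * (V x \<bullet> grushin_grad \<phi> x)\<bar>
        \<le> norm (V x) powr (p - 2) * (norm (V x) * ?D x)"
      unfolding abs_mult using Cauchy_Schwarz_ineq2[of "V x" "grushin_grad \<phi> x"]
      by (simp add: mult_left_mono)
    also have "\<dots> = norm (V x) powr (p - 1) * ?D x"
      unfolding N1[symmetric] by simp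
    finally have "\<bar>?T x - a x\<bar> \<le> p * \<phi> x powr (p - 1) * G (v x) * (norm (V x) powr (p - 1) * ?D x)"
      unfolding T abs_mult using p GC[OF elim] by (simp add: mult_left_mono)
    also have "\<dots> = p * (\<phi> x powr (p - 1) * norm (V x) powr (p - 1) * G (v x) * ?D x)"
      by simp
    also have "\<dots> \<le> (1 - 1 / p) * a x + p powr (p - 1) * b x"
      unfolding a_def b_def
      using p gpos[OF elim] GC[OF elim] nn[of x] by (intro scaled_Young_powr) auto
    finally show ?case .
  qed
  have Tm[measurable]: "?T \<in> borel_measurable ?M"
    using S\<psi> by (auto simp: S1p_def)
  have "integrable ?M (\<lambda>x. ?T x - a x)"
  proof (rule Bochner_Integration.integrable_bound)
    show "integrable ?M (\<lambda>x. (1 - 1 / p) * a x + p powr (p - 1) * b x)"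
      using Ia Ib by simp
    show "(\<lambda>x. ?T x - a x) \<in> borel_measurable ?M"
      using Tm Ia by (auto intro: borel_measurable_diff)
    show "AE x in ?M. norm (?T x - a x) \<le> norm ((1 - 1 / p) * a x + p powr (p - 1) * b x)"
      using AET by eventually_elim (unfold real_norm_def, rule order_trans[OF _ abs_ge_self])
  qed
  from Bochner_Integration.integrable_add[OF this Ia] have IT: "integrable ?M ?T" by simp
  have "(\<integral>x. 1 / p * a x - p powr (p - 1) * b x \<partial>?M) \<le> (\<integral>x. ?T x \<partial>?M)"
  proof (rule integral_mono_AE)
    show "AE x in ?M. 1 / p * a x - p powr (p - 1) * b x \<le> ?T x"
      using AET by eventually_elim (simp add: left_diff_distrib)
  qed (use Ia Ib IT in auto)
  with Tc Ia Ib have "1 / p * (\<integral>x. a x \<partial>?M) - p powr (p - 1) * (\<integral>x. b x \<partial>?M) \<le> lam * (\<integral>x. c x \<partial>?M)"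
    by simp
  then have "p * (1 / p * (\<integral>x. a x \<partial>?M) - p powr (p - 1) * (\<integral>x. b x \<partial>?M)) \<le> p * (lam * (\<integral>x. c x \<partial>?M))"
    using p by (intro mult_left_mono) auto
  moreover have "p * p powr (p - 1) = p powr p"
    using p by (simp add: powr_diff)
  ultimately show "(\<integral>x. a x \<partial>?M) \<le> p powr p * (\<integral>x. b x \<partial>?M) + lam * p * (\<integral>x. c x \<partial>?M)"
    using p by (simp add: algebra_simps flip: mult.assoc)
qed

section \<open>Truncations of powers\<close>

lemma DERIV_le_imp_le:
  fixes G H :: "real \<Rightarrow> real"
  assumes t: "0 \<le> t" and G: "\<And>x. (G has_real_derivative g x) (at x)"
    and H: "\<And>x. 0 \<le> x \<Longrightarrow> x \<le> t \<Longrightarrow> (H has_real_derivative h x) (at x)"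
    and le: "\<And>x. 0 \<le> x \<Longrightarrow> x \<le> t \<Longrightarrow> g x \<le> h x" and 0: "G 0 = H 0"
  shows "G t \<le> H t"
proof -
  have "H 0 - G 0 \<le> H t - G t"
  proof (rule DERIV_nonneg_imp_nondecreasing[OF t])
    fix x assume x: "0 \<le> x" "x \<le> t"
    then show "\<exists>y. ((\<lambda>x. H x - G x) has_real_derivative y) (at x) \<and> 0 \<le> y"
      using DERIV_diff[OF H[OF x] G] le[OF x] by (intro exI[of _ "h x - g x"]) simp
  qed
  with 0 show ?thesis by simp
qed

lemma DERIV_eq_imp_eq:
  fixes G H :: "real \<Rightarrow> real"
  assumes t: "0 \<le> t" and G: "\<And>x. (G has_real_derivative g x) (at x)"
    and H: "\<And>x. 0 \<le> x \<Longrightarrow> x \<le> t \<Longrightarrow> (H has_real_derivative g x) (at x)" and 0: "G 0 = H 0"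
  shows "G t = H t"
proof -
  have "H 0 - G 0 = H t - G t"
  proof (rule antisym)
    show "H 0 - G 0 \<le> H t - G t"
      using DERIV_le_imp_le[OF t G H order_refl 0] 0 by simp
    have "\<exists>y. ((\<lambda>x. H x - G x) has_real_derivative y) (at x) \<and> y \<le> 0" if x: "0 \<le> x" "x \<le> t" for x
      using DERIV_diff[OF H[OF x] G] by (intro exI[of _ 0]) simp
    then show "H t - G t \<le> H 0 - G 0"
      by (intro DERIV_nonpos_imp_nonincreasing[OF t]) auto
  qed
  with 0 show ?thesis by simp
qed

lemma continuous_antiderivative_vanishing:
  fixes g :: "real \<Rightarrow> real"
  assumes "continuous_on UNIV g"
  obtains G where "\<And>t. (G has_real_derivative g t) (at t)" "G 0 = 0"
proof -
  obtain F where F: "\<And>t. (F has_vector_derivative g t) (at t)"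
    using einterval_antiderivative[of "-\<infinity>" "\<infinity>" g] assms
    by (auto simp: continuous_on_eq_continuous_at)
  then have "((\<lambda>t. F t - F 0) has_real_derivative g t) (at t)" for t
    using DERIV_diff[OF F[unfolded has_real_derivative_iff_has_vector_derivative[symmetric]] DERIV_const[of "F 0"]]
    by simp
  then show ?thesis by (intro that[of "\<lambda>t. F t - F 0"]) auto
qed

lemma powr_add_subadditive:
  fixes a b s :: real
  assumes "0 < a" "0 < b" "0 \<le> s" "s \<le> 1"
  shows "(a + b) powr s \<le> a powr s + b powr s"
proof -
  have le: "x / (a + b) \<le> x powr s / (a + b) powr s" if "0 < x" "x < a + b" for x
    using powr_mono'[of s 1 "x / (a + b)"] assms that by (simp add: powr_divide)
  have "1 = a / (a + b) + b / (a + b)"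
    using assms by (simp add: add_divide_distrib[symmetric])
  also have "\<dots> \<le> (a powr s + b powr s) / (a + b) powr s"
    using le[of a] le[of b] assms by (simp add: add_divide_distrib)
  finally show ?thesis using assms by (simp add: field_simps)
qed

definition admissible_truncation :: "real \<Rightarrow> real \<Rightarrow> (real \<Rightarrow> real) \<Rightarrow> (real \<Rightarrow> real) \<Rightarrow> bool" where
  "admissible_truncation s C G g \<longleftrightarrow>
     (\<forall>t. (G has_real_derivative g t) (at t)) \<and> continuous_on UNIV g \<and> (\<exists>L. \<forall>t. \<bar>g t\<bar> \<le> L) \<and>
     (\<forall>t>0. 0 < g t \<and> 0 \<le> G t \<and> G t \<le> t powr s \<and> G t \<le> C * t * g t)"

lemma ex_admissible_truncation_sublinear:
  assumes s: "0 < s" "s \<le> 1" and e: "0 < e"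
  obtains G where "admissible_truncation s (1 / s) G (\<lambda>t. s * (\<bar>t\<bar> + e) powr (s - 1))"
    "\<And>t. 0 < t \<Longrightarrow> G t = (t + e) powr s - e powr s"
proof -
  let ?g = "\<lambda>t. s * (\<bar>t\<bar> + e) powr (s - 1)"
  have c: "continuous_on UNIV ?g"
    using e by (intro continuous_intros) (auto simp: add_nonneg_eq_0_iff)
  obtain G where G: "\<And>t. (G has_real_derivative ?g t) (at t)" "G 0 = 0"
    by (rule continuous_antiderivative_vanishing[OF c]) blast
  have eq: "G t = (t + e) powr s - e powr s" if t: "0 \<le> t" for t
  proof (rule DERIV_eq_imp_eq[OF t G(1)])
    fix x :: real assume x: "0 \<le> x"
    then show "((\<lambda>t. (t + e) powr s - e powr s) has_real_derivative ?g x) (at x)"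
      using e by (auto intro!: derivative_eq_intros simp: powr_diff)
  qed (simp add: G(2))
  have L: "\<bar>?g t\<bar> \<le> s * e powr (s - 1)" for t
    using s e by (simp add: abs_mult powr_mono2')
  have "0 < ?g t \<and> 0 \<le> G t \<and> G t \<le> t powr s \<and> G t \<le> 1 / s * t * ?g t" if t: "0 < t" for t
  proof (intro conjI)
    show "0 < ?g t" using s e t by simp
    show "0 \<le> G t" using s e t by (simp add: eq powr_mono2)
    show "G t \<le> t powr s" using powr_add_subadditive[of t e s] s e t by (simp add: eq)
    have "e * (t + e) powr (s - 1) \<le> e * e powr (s - 1)"
      using s e t by (intro mult_left_mono powr_mono2') auto
    moreover have "(t + e) powr s = (t + e) * (t + e) powr (s - 1)" "e powr s = e * e powr (s - 1)"
      using e t by (simp_all add: powr_diff)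
    ultimately show "G t \<le> 1 / s * t * ?g t"
      using s t by (simp add: eq algebra_simps)
  qed
  then show ?thesis
    using G c L eq by (intro that[of G]) (auto simp: admissible_truncation_def)
qed

lemma ex_admissible_truncation_superlinear:
  assumes s: "1 < s" and N: "0 < N"
  obtains G where "admissible_truncation s 1 G (\<lambda>t. s * min N \<bar>t\<bar> powr (s - 1))"
    "\<And>t. 0 < t \<Longrightarrow> t \<le> N \<Longrightarrow> G t = t powr s"
proof -
  let ?g = "\<lambda>t. s * min N \<bar>t\<bar> powr (s - 1)"
  have c: "continuous_on UNIV ?g"
    using N s by (intro continuous_intros continuous_on_powr') auto
  obtain G where G: "\<And>t. (G has_real_derivative ?g t) (at t)" "G 0 = 0"
    by (rule continuous_antiderivative_vanishing[OF c]) blast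
  have D: "((\<lambda>x. \<bar>x\<bar> powr s) has_real_derivative s * \<bar>x\<bar> powr (s - 1)) (at x)" if "0 \<le> x" for x
    using has_real_derivative_abs_powr[OF s, of x] that by (cases "x = 0") auto
  have eq: "G t = t powr s" if t: "0 < t" "t \<le> N" for t
  proof -
    have "G t = \<bar>t\<bar> powr s"
    proof (rule DERIV_eq_imp_eq[OF _ G(1)])
      fix x assume "0 \<le> x" "x \<le> t"
      then have "min N \<bar>x\<bar> = \<bar>x\<bar>" using t by simp
      with D[OF \<open>0 \<le> x\<close>] show "((\<lambda>x. \<bar>x\<bar> powr s) has_real_derivative ?g x) (at x)"
        by (simp only:)
    qed (use t s in \<open>simp_all add: G(2)\<close>)
    with t show ?thesis by simp
  qed
  have L: "\<bar>?g t\<bar> \<le> s * N powr (s - 1)" for t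
    using s N by (simp add: abs_mult powr_mono2)
  have "0 < ?g t \<and> 0 \<le> G t \<and> G t \<le> t powr s \<and> G t \<le> 1 * t * ?g t" if t: "0 < t" for t
  proof (intro conjI)
    show "0 < ?g t" using s N t by simp
    show "0 \<le> G t"
    proof -
      have "G 0 \<le> G t"
      proof (rule DERIV_nonneg_imp_nondecreasing[where f = G and a = 0 and b = t])
        fix x
        have "0 \<le> ?g x" using s by simp
        with G(1)[of x] show "\<exists>y. (G has_real_derivative y) (at x) \<and> 0 \<le> y" by blast
      qed (use t in simp)
      then show ?thesis by (simp add: G(2))
    qed
    have "G t \<le> \<bar>t\<bar> powr s"
    proof (rule DERIV_le_imp_le[OF _ G(1), where h = "\<lambda>x. s * \<bar>x\<bar> powr (s - 1)"])
      show "((\<lambda>x. \<bar>x\<bar> powr s) has_real_derivative s * \<bar>x\<bar> powr (s - 1)) (at x)" if "0 \<le> x" for x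
        using D[OF that] .
      show "?g x \<le> s * \<bar>x\<bar> powr (s - 1)" for x
        using s N by (intro mult_left_mono powr_mono2) auto
    qed (use t s in \<open>simp_all add: G(2)\<close>)
    with t show "G t \<le> t powr s" by simp
    have "G t \<le> ?g t * t"
    proof (rule DERIV_le_imp_le[OF _ G(1), where h = "\<lambda>x. ?g t" and H = "\<lambda>x. ?g t * x"])
      show "((\<lambda>x. ?g t * x) has_real_derivative ?g t) (at x)" for x
        by (auto intro!: derivative_eq_intros)
      show "?g x \<le> ?g t" if "0 \<le> x" "x \<le> t" for x
        using s N that by (intro mult_left_mono powr_mono2) auto
    qed (use t in \<open>simp_all add: G(2)\<close>)
    then show "G t \<le> 1 * t * ?g t" by (simp add: mult_ac)
  qed
  then show ?thesis
    using G c L eq by (intro that[of G]) (auto simp: admissible_truncation_def)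
qed

lemma powr_truncation_sequence:
  fixes s :: real
  assumes s: "0 < s"
  obtains C :: real and G g :: "nat \<Rightarrow> real \<Rightarrow> real" where "0 \<le> C"
    "\<And>n. admissible_truncation s C (G n) (g n)"
    "\<And>t. 0 < t \<Longrightarrow> (\<lambda>n. G n t) \<longlonglongrightarrow> t powr s"
    "\<And>t. 0 < t \<Longrightarrow> (\<lambda>n. g n t) \<longlonglongrightarrow> s * t powr (s - 1)"
proof (cases "s \<le> 1")
  case True
  let ?e = "\<lambda>n. inverse (real (Suc n))"
  let ?g = "\<lambda>n t. s * (\<bar>t\<bar> + ?e n) powr (s - 1)"
  have "\<exists>G. admissible_truncation s (1 / s) G (?g n) \<and> (\<forall>t>0. G t = (t + ?e n) powr s - ?e n powr s)" for n
    using ex_admissible_truncation_sublinear[OF s True, of "?e n"] by (metis inverse_positive_iff_positive of_nat_0_less_iff zero_less_Suc)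
  then obtain G where G: "\<And>n. admissible_truncation s (1 / s) (G n) (?g n)"
      "\<And>n t. 0 < t \<Longrightarrow> G n t = (t + ?e n) powr s - ?e n powr s"
    by metis
  note e = LIMSEQ_inverse_real_of_nat
  show ?thesis
  proof (rule that[of "1 / s" G ?g])
    fix t :: real assume t: "0 < t"
    have "(\<lambda>n. (t + ?e n) powr s - ?e n powr s) \<longlonglongrightarrow> (t + 0) powr s - 0 powr s"
      using s t by (intro tendsto_intros tendsto_powr' e) auto
    then show "(\<lambda>n. G n t) \<longlonglongrightarrow> t powr s" using t s by (simp add: G(2))
    have "(\<lambda>n. ?g n t) \<longlonglongrightarrow> s * (\<bar>t\<bar> + 0) powr (s - 1)"
      using t by (intro tendsto_intros e) auto
    then show "(\<lambda>n. ?g n t) \<longlonglongrightarrow> s * t powr (s - 1)" using t by simp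
  qed (use s G in auto)
next
  case False
  then have s1: "1 < s" by simp
  let ?N = "\<lambda>n. real (Suc n)"
  let ?g = "\<lambda>n t. s * min (?N n) \<bar>t\<bar> powr (s - 1)"
  have "\<exists>G. admissible_truncation s 1 G (?g n) \<and> (\<forall>t>0. t \<le> ?N n \<longrightarrow> G t = t powr s)" for n
    using ex_admissible_truncation_superlinear[OF s1, of "?N n"] by (metis of_nat_0_less_iff zero_less_Suc)
  then obtain G where G: "\<And>n. admissible_truncation s 1 (G n) (?g n)"
      "\<And>n t. 0 < t \<Longrightarrow> t \<le> ?N n \<Longrightarrow> G n t = t powr s"
    by metis
  show ?thesis
  proof (rule that[of 1 G ?g])
    fix t :: real assume t: "0 < t"
    obtain m where "t \<le> real m" using real_arch_simple by blast
    then have ev: "\<forall>\<^sub>F n in sequentially. t \<le> ?N n"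
      by (auto simp: eventually_sequentially intro!: exI[of _ m])
    show "(\<lambda>n. G n t) \<longlonglongrightarrow> t powr s"
      by (rule tendsto_eventually) (use ev in eventually_elim, use G(2) t in blast)
    show "(\<lambda>n. ?g n t) \<longlonglongrightarrow> s * t powr (s - 1)"
      by (rule tendsto_eventually) (use ev in eventually_elim, use t in simp)
  qed (use G in auto)
qed

lemma nn_integral_le_of_AE_limit:
  fixes u :: "nat \<Rightarrow> 'a \<Rightarrow> ennreal"
  assumes [measurable]: "\<And>n. u n \<in> borel_measurable M"
    and lim: "AE x in M. (\<lambda>n. u n x) \<longlonglongrightarrow> f x"
    and le: "\<And>n. (\<integral>\<^sup>+x. u n x \<partial>M) \<le> r n" and r: "r \<longlonglongrightarrow> R"
  shows "(\<integral>\<^sup>+x. f x \<partial>M) \<le> R"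
proof -
  have "(\<integral>\<^sup>+x. f x \<partial>M) = (\<integral>\<^sup>+x. liminf (\<lambda>n. u n x) \<partial>M)"
    using lim by (intro nn_integral_cong_AE) (auto dest!: lim_imp_Liminf[rotated])
  also have "\<dots> \<le> liminf (\<lambda>n. \<integral>\<^sup>+x. u n x \<partial>M)"
    by (rule nn_integral_liminf) simp
  also have "\<dots> \<le> liminf r"
    using le by (intro Liminf_mono) simp
  also have "\<dots> = R"
    using r by (intro lim_imp_Liminf) simp_all
  finally show ?thesis .
qed

section \<open>Passage to the limit\<close>

text \<open>The positive and negative parts of \<open>lam\<close> stand on opposite sides, so that both sides are sums in
  \<open>ennreal\<close> even when the integrals are infinite.\<close>

lemma power_Caccioppoli:
  fixes \<Omega> :: "plane set" and p lam s :: real and v \<phi> :: "plane \<Rightarrow> real" and V :: "plane \<Rightarrow> plane"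
  assumes \<Omega>: "\<Omega> \<in> sets lebesgue" and p: "1 < p" and sub: "grushin_subsolution p lam \<Omega> v V"
    and pos: "AE x in lebesgue_on \<Omega>. 0 < v x"
    and \<phi>: "\<phi> \<in> C01 \<Omega>" and nn: "\<And>x. 0 \<le> \<phi> x" and s: "0 < s"
  defines "A \<equiv> \<integral>\<^sup>+x. ennreal (v x powr (s - 1) * \<phi> x powr p * norm (V x) powr p) \<partial>lebesgue_on \<Omega>"
    and "B \<equiv> \<integral>\<^sup>+x. ennreal (v x powr (s + p - 1) * norm (grushin_grad \<phi> x) powr p) \<partial>lebesgue_on \<Omega>"
    and "C \<equiv> \<integral>\<^sup>+x. ennreal (v x powr (s + p - 1) * \<phi> x powr p) \<partial>lebesgue_on \<Omega>"
  shows "ennreal s * A + ennreal (max 0 (- lam) * p) * C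
    \<le> ennreal (p powr p * s powr (1 - p)) * B + ennreal (max 0 lam * p) * C"
proof (cases "B = \<infinity>")
  case True
  then show ?thesis using p s by (simp add: ennreal_mult_top)
next
  case False
  let ?M = "lebesgue_on \<Omega>"
  let ?D = "\<lambda>x. norm (grushin_grad \<phi> x)"
  note \<phi>1 = C01_D(1)[OF \<phi>]
  have [measurable]: "\<phi> \<in> borel_measurable ?M" "grushin_grad \<phi> \<in> borel_measurable ?M"
    by (rule borel_measurable_continuous_lebesgue_on[OF _ \<Omega>] Ck_1_imp_continuous
        Ck_1_imp_continuous_grad \<phi>1)+
  have [measurable]: "v \<in> borel_measurable ?M" "V \<in> borel_measurable ?M"
    using sub by (auto simp: grushin_subsolution_def S1p_def)
  obtain \<kappa> :: real and G g :: "nat \<Rightarrow> real \<Rightarrow> real" where \<kappa>: "0 \<le> \<kappa>"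
    and adm: "\<And>n. admissible_truncation s \<kappa> (G n) (g n)"
    and limG: "\<And>t. 0 < t \<Longrightarrow> (\<lambda>n. G n t) \<longlonglongrightarrow> t powr s"
    and limg: "\<And>t. 0 < t \<Longrightarrow> (\<lambda>n. g n t) \<longlonglongrightarrow> s * t powr (s - 1)"
    using powr_truncation_sequence[OF s] by blast
  have gpos: "0 < g n t" "0 \<le> G n t" "G n t \<le> t powr s" "G n t \<le> \<kappa> * t * g n t" if "0 < t" for n t
    using adm[of n] that unfolding admissible_truncation_def by blast+
  define a where "a n x = \<phi> x powr p * g n (v x) * norm (V x) powr p" for n x
  define b where "b n x = g n (v x) * (G n (v x) / g n (v x)) powr p * ?D x powr p" for n x
  define c where "c n x = v x powr (p - 1) * G n (v x) * \<phi> x powr p" for n x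
  have T: "integrable ?M (a n)" "integrable ?M (b n)" "integrable ?M (c n)"
    "(\<integral>x. a n x \<partial>?M) \<le> p powr p * (\<integral>x. b n x \<partial>?M) + lam * p * (\<integral>x. c n x \<partial>?M)" for n
  proof -
    obtain L where "\<And>t. (G n has_real_derivative g n t) (at t)" "continuous_on UNIV (g n)" "\<And>t. \<bar>g n t\<bar> \<le> L"
      using adm[of n] unfolding admissible_truncation_def by blast
    note t = truncated_Caccioppoli[OF \<Omega> p sub pos \<phi> nn this gpos(1) conjI[OF gpos(2) gpos(4)],
        folded a_def[abs_def] b_def[abs_def] c_def[abs_def]]
    show "integrable ?M (a n)" "integrable ?M (b n)" "integrable ?M (c n)"
    "(\<integral>x. a n x \<partial>?M) \<le> p powr p * (\<integral>x. b n x \<partial>?M) + lam * p * (\<integral>x. c n x \<partial>?M)"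
      unfolding a_def[abs_def] b_def[abs_def] c_def[abs_def] using t by simp_all
  qed
  note [measurable] = T(1-3)[THEN borel_measurable_integrable]
  have nna: "AE x in ?M. 0 \<le> a n x" for n
    using pos by eventually_elim (unfold a_def, intro mult_nonneg_nonneg powr_ge_zero less_imp_le[OF gpos(1)])
  have nnb: "AE x in ?M. 0 \<le> b n x" for n
    using pos by eventually_elim (unfold b_def, intro mult_nonneg_nonneg powr_ge_zero less_imp_le[OF gpos(1)])
  have nnc: "AE x in ?M. 0 \<le> c n x" for n
    using pos by eventually_elim (unfold c_def, intro mult_nonneg_nonneg powr_ge_zero gpos(2))
  have int0: "0 \<le> (\<integral>x. a n x \<partial>?M)" "0 \<le> (\<integral>x. b n x \<partial>?M)" "0 \<le> (\<integral>x. c n x \<partial>?M)" for n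
    using nna nnb nnc by (auto intro: integral_nonneg_AE)
  have nn_eq: "(\<integral>\<^sup>+x. ennreal (a n x) \<partial>?M) = ennreal (\<integral>x. a n x \<partial>?M)"
    "(\<integral>\<^sup>+x. ennreal (b n x) \<partial>?M) = ennreal (\<integral>x. b n x \<partial>?M)"
    "(\<integral>\<^sup>+x. ennreal (c n x) \<partial>?M) = ennreal (\<integral>x. c n x \<partial>?M)" for n
    using T nna nnb nnc by (auto intro: nn_integral_eq_integral)
  have powq: "t powr s * t powr (p - 1) = t powr (s + p - 1)" for t :: real
    by (simp add: powr_add[symmetric] add_diff_eq)
  have cC: "(\<integral>\<^sup>+x. ennreal (c n x) \<partial>?M) \<le> C" for n
    unfolding C_def
  proof (rule nn_integral_mono_AE)
    show "AE x in ?M. ennreal (c n x) \<le> ennreal (v x powr (s + p - 1) * \<phi> x powr p)"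
      using pos
    proof eventually_elim
      case (elim x)
      have "c n x \<le> v x powr (p - 1) * v x powr s * \<phi> x powr p"
        unfolding c_def using gpos[OF elim] by (intro mult_mono) auto
      then show ?case
        by (intro ennreal_leI) (simp add: powq[symmetric] mult_ac)
    qed
  qed
  have le: "(\<integral>\<^sup>+x. ennreal (a n x) + ennreal (max 0 (- lam) * p) * ennreal (c n x) \<partial>?M)
      \<le> ennreal (p powr p) * (\<integral>\<^sup>+x. ennreal (b n x) \<partial>?M) + ennreal (max 0 lam * p) * C" for n
  proof -
    have "lam * p * (\<integral>x. c n x \<partial>?M) = max 0 lam * p * (\<integral>x. c n x \<partial>?M) - max 0 (- lam) * p * (\<integral>x. c n x \<partial>?M)"
      by (simp add: max_def)
    then have "(\<integral>x. a n x \<partial>?M) + max 0 (- lam) * p * (\<integral>x. c n x \<partial>?M)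
        \<le> p powr p * (\<integral>x. b n x \<partial>?M) + max 0 lam * p * (\<integral>x. c n x \<partial>?M)"
      using T(4)[of n] by linarith
    from ennreal_leI[OF this]
    have "ennreal (\<integral>x. a n x \<partial>?M) + ennreal (max 0 (- lam) * p) * ennreal (\<integral>x. c n x \<partial>?M)
        \<le> ennreal (p powr p) * ennreal (\<integral>x. b n x \<partial>?M) + ennreal (max 0 lam * p) * ennreal (\<integral>x. c n x \<partial>?M)"
      using int0[of n] p by (simp add: ennreal_mult[symmetric] ennreal_plus[symmetric] del: ennreal_plus)
    also have "\<dots> \<le> ennreal (p powr p) * ennreal (\<integral>x. b n x \<partial>?M) + ennreal (max 0 lam * p) * C"
      using cC[of n] by (intro add_left_mono mult_left_mono) (auto simp: nn_eq)
    finally show ?thesis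
      by (simp add: nn_integral_add nn_integral_cmult nn_eq)
  qed
  have limB: "(\<lambda>n. \<integral>\<^sup>+x. ennreal (b n x) \<partial>?M) \<longlonglongrightarrow> ennreal (s powr (1 - p)) * B"
  proof -
    have "(\<lambda>n. \<integral>\<^sup>+x. ennreal (b n x) \<partial>?M) \<longlonglongrightarrow>
        (\<integral>\<^sup>+x. ennreal (s powr (1 - p)) * ennreal (v x powr (s + p - 1) * ?D x powr p) \<partial>?M)"
    proof (rule nn_integral_dominated_convergence[where w = "\<lambda>x. ennreal (\<kappa> powr (p - 1)) * ennreal (v x powr (s + p - 1) * ?D x powr p)"])
      show "(\<lambda>x. ennreal (\<kappa> powr (p - 1)) * ennreal (v x powr (s + p - 1) * ?D x powr p)) \<in> borel_measurable ?M"
        "(\<lambda>x. ennreal (s powr (1 - p)) * ennreal (v x powr (s + p - 1) * ?D x powr p)) \<in> borel_measurable ?M"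
        by measurable
      have "(\<integral>\<^sup>+x. ennreal (\<kappa> powr (p - 1)) * ennreal (v x powr (s + p - 1) * ?D x powr p) \<partial>?M)
          = ennreal (\<kappa> powr (p - 1)) * B"
        unfolding B_def by (rule nn_integral_cmult) measurable
      also have "\<dots> < \<infinity>"
        using False by (simp add: ennreal_mult_less_top less_top)
      finally show "(\<integral>\<^sup>+x. ennreal (\<kappa> powr (p - 1)) * ennreal (v x powr (s + p - 1) * ?D x powr p) \<partial>?M) < \<infinity>" .
      show "AE x in ?M. ennreal (b n x) \<le> ennreal (\<kappa> powr (p - 1)) * ennreal (v x powr (s + p - 1) * ?D x powr p)" for n
        using pos
      proof eventually_elim
        case (elim x)
        define h where "h = G n (v x) / g n (v x)"
        have h: "0 \<le> h" "h \<le> \<kappa> * v x" "G n (v x) = g n (v x) * h"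
          using gpos[OF elim, of n] by (auto simp: h_def field_simps)
        have hp: "h powr p = h * h powr (p - 1)"
          using h(1) p by (cases "h = 0") (auto simp: powr_diff)
        have "g n (v x) * h powr p = G n (v x) * h powr (p - 1)"
          by (simp add: hp h(3))
        also have "\<dots> \<le> v x powr s * (\<kappa> * v x) powr (p - 1)"
          using gpos[OF elim, of n] h p by (intro mult_mono powr_mono2) auto
        also have "\<dots> = \<kappa> powr (p - 1) * v x powr (s + p - 1)"
          using \<kappa> elim by (simp add: powr_mult powq[symmetric])
        finally have "b n x \<le> \<kappa> powr (p - 1) * v x powr (s + p - 1) * ?D x powr p"
          unfolding b_def h_def[symmetric] by (intro mult_right_mono) auto
        then show ?case
          by (simp add: ennreal_mult'[symmetric] ennreal_leI mult.assoc)
      qed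
      show "AE x in ?M. (\<lambda>n. ennreal (b n x)) \<longlonglongrightarrow> ennreal (s powr (1 - p)) * ennreal (v x powr (s + p - 1) * ?D x powr p)"
        using pos
      proof eventually_elim
        case (elim x)
        let ?t = "v x"
        have "?t powr s / (s * ?t powr (s - 1)) = ?t / s"
          using elim s by (simp add: powr_diff)
        moreover have "(\<lambda>n. G n ?t / g n ?t) \<longlonglongrightarrow> ?t powr s / (s * ?t powr (s - 1))"
          using elim s by (intro tendsto_intros limG limg) auto
        ultimately have "(\<lambda>n. G n ?t / g n ?t) \<longlonglongrightarrow> ?t / s" by (simp only:)
        then have "(\<lambda>n. (G n ?t / g n ?t) powr p) \<longlonglongrightarrow> (?t / s) powr p"
          using elim s by (intro tendsto_powr tendsto_const) auto
        then have "(\<lambda>n. b n x) \<longlonglongrightarrow> s * ?t powr (s - 1) * (?t / s) powr p * ?D x powr p"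
          unfolding b_def by (rule tendsto_mult[OF tendsto_mult[OF limg[OF elim]] tendsto_const])
        also have "s * ?t powr (s - 1) * (?t / s) powr p * ?D x powr p = s powr (1 - p) * (?t powr (s + p - 1) * ?D x powr p)"
          using elim s by (simp add: powr_divide powr_diff powr_add mult_ac)
        finally show ?case
          by (simp add: ennreal_mult'[symmetric] tendsto_ennrealI)
      qed
    qed measurable
    also have "(\<integral>\<^sup>+x. ennreal (s powr (1 - p)) * ennreal (v x powr (s + p - 1) * ?D x powr p) \<partial>?M)
        = ennreal (s powr (1 - p)) * B"
      unfolding B_def by (rule nn_integral_cmult) measurable
    finally show ?thesis .
  qed
  have "(\<integral>\<^sup>+x. ennreal s * ennreal (v x powr (s - 1) * \<phi> x powr p * norm (V x) powr p)
        + ennreal (max 0 (- lam) * p) * ennreal (v x powr (s + p - 1) * \<phi> x powr p) \<partial>?M)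
      \<le> ennreal (p powr p) * (ennreal (s powr (1 - p)) * B) + ennreal (max 0 lam * p) * C"
  proof (rule nn_integral_le_of_AE_limit[OF _ _ le])
    show "(\<lambda>n. ennreal (p powr p) * (\<integral>\<^sup>+x. ennreal (b n x) \<partial>?M) + ennreal (max 0 lam * p) * C)
        \<longlonglongrightarrow> ennreal (p powr p) * (ennreal (s powr (1 - p)) * B) + ennreal (max 0 lam * p) * C"
      by (intro tendsto_add ennreal_tendsto_cmult limB tendsto_const) simp
    show "AE x in ?M. (\<lambda>n. ennreal (a n x) + ennreal (max 0 (- lam) * p) * ennreal (c n x)) \<longlonglongrightarrow>
        ennreal s * ennreal (v x powr (s - 1) * \<phi> x powr p * norm (V x) powr p)
        + ennreal (max 0 (- lam) * p) * ennreal (v x powr (s + p - 1) * \<phi> x powr p)"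
      using pos
    proof eventually_elim
      case (elim x)
      have "(\<lambda>n. a n x) \<longlonglongrightarrow> \<phi> x powr p * (s * v x powr (s - 1)) * norm (V x) powr p"
        unfolding a_def by (intro tendsto_intros limg elim)
      moreover have "(\<lambda>n. c n x) \<longlonglongrightarrow> v x powr (p - 1) * v x powr s * \<phi> x powr p"
        unfolding c_def by (intro tendsto_intros limG elim)
      ultimately have "(\<lambda>n. ennreal (a n x) + ennreal (max 0 (- lam) * p) * ennreal (c n x)) \<longlonglongrightarrow>
        ennreal (\<phi> x powr p * (s * v x powr (s - 1)) * norm (V x) powr p)
        + ennreal (max 0 (- lam) * p) * ennreal (v x powr (p - 1) * v x powr s * \<phi> x powr p)"
        by (intro tendsto_add ennreal_tendsto_cmult tendsto_ennrealI) simp_all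
      moreover have "\<phi> x powr p * (s * v x powr (s - 1)) * norm (V x) powr p
          = s * (v x powr (s - 1) * \<phi> x powr p * norm (V x) powr p)" by simp
      moreover have "v x powr (p - 1) * v x powr s = v x powr (s + p - 1)"
        by (simp add: powq[symmetric])
      ultimately show ?case using s by (simp add: ennreal_mult')
    qed
  qed measurable
  moreover have "(\<integral>\<^sup>+x. ennreal s * ennreal (v x powr (s - 1) * \<phi> x powr p * norm (V x) powr p)
        + ennreal (max 0 (- lam) * p) * ennreal (v x powr (s + p - 1) * \<phi> x powr p) \<partial>?M)
      = ennreal s * A + ennreal (max 0 (- lam) * p) * C"
    unfolding A_def C_def by (simp add: nn_integral_add nn_integral_cmult)
  ultimately show ?thesis
    using p by (simp add: ennreal_mult mult.assoc)
qed

lemma ennreal_weighted_le_imp_ereal_le: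
  fixes A B C :: ennreal and s k m :: real
  assumes s: "0 < s" and k: "0 < k"
    and le: "ennreal s * A + ennreal (max 0 (- m)) * C \<le> ennreal k * B + ennreal (max 0 m) * C"
  shows "enn2ereal A \<le> ereal (k / s) * enn2ereal B + ereal (m / s) * enn2ereal C"
proof (cases "0 \<le> m")
  case True
  have "ennreal s * A \<le> ennreal k * B + ennreal m * C"
    using le True by (simp add: max.absorb1 max.absorb2)
  then have "ennreal (1 / s) * (ennreal s * A) \<le> ennreal (1 / s) * (ennreal k * B + ennreal m * C)"
    by (rule mult_left_mono) simp
  then have "A \<le> ennreal (k / s) * B + ennreal (m / s) * C"
    using s k True by (simp add: distrib_left ennreal_mult[symmetric] flip: mult.assoc)
  then have "enn2ereal A \<le> enn2ereal (ennreal (k / s) * B + ennreal (m / s) * C)"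
    by (simp add: less_eq_ennreal.rep_eq)
  then show ?thesis
    using s k True by (simp add: plus_ennreal.rep_eq times_ennreal.rep_eq enn2ereal_ennreal)
next
  case False
  show ?thesis
  proof (cases "B = \<infinity>")
    case True
    then have "ereal (k / s) * enn2ereal B = \<infinity>" using s k by (simp add: enn2ereal_top infinity_ennreal_def)
    then show ?thesis by (simp only: plus_ereal.simps ereal_less_eq)
  next
    case B: False
    have le': "ennreal s * A + ennreal (- m) * C \<le> ennreal k * B"
      using le False by (simp add: max_def)
    also have "\<dots> < \<infinity>"
      using B by (simp add: ennreal_mult_less_top less_top)
    finally have "ennreal s * A + ennreal (- m) * C < \<infinity>" .
    then have "A < \<infinity>" "C < \<infinity>"
      using s False by (auto simp: ennreal_mult_less_top)
    then obtain a b c where r: "A = ennreal a" "0 \<le> a" "B = ennreal b" "0 \<le> b" "C = ennreal c" "0 \<le> c"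
      using B by (cases A; cases B; cases C) auto
    have "s * a + (- m) * c \<le> k * b"
    proof -
      have "ennreal (s * a + (- m) * c) = ennreal (s * a) + ennreal ((- m) * c)"
        using s False r by (intro ennreal_plus mult_nonneg_nonneg) auto
      also have "\<dots> = ennreal s * A + ennreal (- m) * C"
        unfolding r using s False r(2,6) by (subst (1 2) ennreal_mult) auto
      also have "\<dots> \<le> ennreal (k * b)"
        using le' k r(4) unfolding r(3) by (simp add: ennreal_mult)
      finally have "ennreal (s * a + (- m) * c) \<le> ennreal (k * b)" .
      then show ?thesis using k r by (subst (asm) ennreal_le_iff) auto
    qed
    then have "a \<le> k / s * b + m / s * c"
      using s by (simp add: field_simps)
    then show ?thesis
      using r by (simp add: enn2ereal_ennreal)
  qed
qed

theorem corollary3p2: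
  fixes \<Omega> :: "plane set" and p lam :: real
    and v :: "plane \<Rightarrow> real" and grad_v :: "plane \<Rightarrow> plane"
  assumes "open \<Omega>" and "1 < p"
    and "grushin_subsolution p lam \<Omega> v grad_v"
    and "AE x in lebesgue_on \<Omega>. 0 < v x"
  shows "(\<forall>q > p - 1. \<forall>\<phi> \<in> C0_infinity \<Omega>. (\<forall>x. 0 \<le> \<phi> x) \<longrightarrow>
            ext_integral \<Omega> (\<lambda>x. v x powr (q - p) * \<phi> x powr p * norm (grad_v x) powr p)
              \<le> ereal ((p / (q - p + 1)) powr p)
                   * ext_integral \<Omega> (\<lambda>x. v x powr q * norm (grushin_grad \<phi> x) powr p)
                + ereal (lam * p / (q - p + 1))
                   * ext_integral \<Omega> (\<lambda>x. v x powr q * \<phi> x powr p))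
       \<and> (lam = 0 \<longrightarrow> (\<forall>\<phi> \<in> C0_infinity \<Omega>. (\<forall>x. 0 \<le> \<phi> x) \<longrightarrow>
            ext_integral \<Omega> (\<lambda>x. \<phi> x powr p * norm (grad_v x) powr p)
              \<le> ereal (p powr p)
                   * ext_integral \<Omega> (\<lambda>x. v x powr p * norm (grushin_grad \<phi> x) powr p)))"
proof -
  have \<Omega>: "\<Omega> \<in> sets lebesgue" using assms(1) by simp
  have general: "ext_integral \<Omega> (\<lambda>x. v x powr (q - p) * \<phi> x powr p * norm (grad_v x) powr p)
      \<le> ereal ((p / (q - p + 1)) powr p)
           * ext_integral \<Omega> (\<lambda>x. v x powr q * norm (grushin_grad \<phi> x) powr p)
        + ereal (lam * p / (q - p + 1)) * ext_integral \<Omega> (\<lambda>x. v x powr q * \<phi> x powr p)"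
    if q: "p - 1 < q" and \<phi>: "\<phi> \<in> C0_infinity \<Omega>" and nn: "\<forall>x. 0 \<le> \<phi> x" for q \<phi>
  proof -
    define s where "s = q - p + 1"
    have s: "0 < s" "s - 1 = q - p" "s + p - 1 = q" using q by (simp_all add: s_def)
    have \<phi>1: "\<phi> \<in> C01 \<Omega>"
      using \<phi> unfolding C0_infinity_def C01_def by blast
    have m: "max 0 (- lam) * p = max 0 (- (lam * p))" "max 0 lam * p = max 0 (lam * p)"
      using assms(2) by (auto simp: max_def mult_le_0_iff zero_le_mult_iff)
    have "p powr p * s powr (1 - p) / s = (p / s) powr p"
      using s assms(2) by (simp add: powr_divide powr_diff)
    with ennreal_weighted_le_imp_ereal_le[OF s(1) _
        power_Caccioppoli[OF \<Omega> assms(2-4) \<phi>1 _ s(1), unfolded s(2-3) m]]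
    show ?thesis
      using nn s(1) assms(2) unfolding ext_integral_def s_def[symmetric] by simp
  qed
  moreover have "ext_integral \<Omega> (\<lambda>x. \<phi> x powr p * norm (grad_v x) powr p)
      \<le> ereal (p powr p) * ext_integral \<Omega> (\<lambda>x. v x powr p * norm (grushin_grad \<phi> x) powr p)"
    if lam: "lam = 0" and \<phi>: "\<phi> \<in> C0_infinity \<Omega>" and nn: "\<forall>x. 0 \<le> \<phi> x" for \<phi>
  proof -
    have "ext_integral \<Omega> (\<lambda>x. v x powr (p - p) * \<phi> x powr p * norm (grad_v x) powr p)
        = ext_integral \<Omega> (\<lambda>x. \<phi> x powr p * norm (grad_v x) powr p)"
      unfolding ext_integral_def
      by (intro arg_cong[where f = enn2ereal] nn_integral_cong_AE)
         (use assms(4) in eventually_elim, simp)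
    with general[OF _ \<phi> nn, of p] show ?thesis
      using lam by (simp add: zero_ereal_def[symmetric])
  qed
  ultimately show ?thesis by blast
qed

end
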